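(* Let $\overline{\mathfrak{gl}(n)}$ be the Lax operator algebra over $\mathfrak{gl}(n)$ with Tyurin parameters $\{(\alpha_s,\gamma_s)\}$. Let $\mathcal{L}$ be a meromorphic $\mathfrak{gl}(n)$-valued 1-form on $\Gamma$, holomorphic outside $P_\pm$ and the points $\gamma_s$, such that at every $\gamma_s$ (with local coordinate $z$ vanishing at $\gamma_s$) $$\mathcal{L}=\mathcal{L}_{-1}\frac{dz}{z}+\mathcal{L}_0\,dz+\ldots,\qquad \mathcal{L}_{-1}=\alpha_s\tilde\beta_s^t,\quad \tilde\beta_s^t\alpha_s=1,\quad \mathcal{L}_0\alpha_s=\tilde k_s\alpha_s$$ for some $\tilde\beta_s\in\mathbb{C}^n$ and $\tilde k_s\in\mathbb{C}$. Then for all $L,L'\in\overline{\mathfrak{gl}(n)}$ the 1-form $\operatorname{tr}(L\,dL'-[L,L']\mathcal{L})$ is regular except at the points $P_\pm$, and the expression $$\gamma(L,L')=\operatorname{res}_{P_+}\operatorname{tr}(L\,dL'-[L,L']\mathcal{L})$$ gives a local 2-cocycle on the Lax operator algebra $\overline{\mathfrak{gl}(n)}$.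
   Context: $\Gamma$ is a compact Riemann surface of genus $g$ with two distinct marked points $P_+,P_-$ (in general position). Fix further distinct points $\gamma_s\in\Gamma\setminus\{P_+,P_-\}$, $s=1,\ldots,ng$ (weak singularities), and nonzero vectors $\alpha_s\in\mathbb{C}^n$ (Tyurin parameters). The Lax operator algebra $\overline{\mathfrak{gl}(n)}$ is the Lie algebra, under pointwise bracket, of meromorphic functions $L:\Gamma\to\mathfrak{gl}(n)$, holomorphic outside $P_\pm$ and the $\gamma_s$ (arbitrary finite-order poles at $P_\pm$), such that at every $\gamma_s$ one has $L=L_{s,-1}z^{-1}+L_{s0}+O(z)$ with $L_{s,-1}=\alpha_s\beta_s^t$ for some $\beta_s\in\mathbb{C}^n$ with $\beta_s^t\alpha_s=0$, and $L_{s0}\alpha_s=k_s\alpha_s$ for some $k_s\in\mathbb{C}$. $\overline{\mathfrak{sl}(n)}$ is the subalgebra of those $L$ with $\operatorname{tr}L=0$. Homogeneous subspaces: $\mathfrak{sl}(n)_m$ ($m\in\mathbb{Z}$) consists of $L\in\overline{\mathfrak{sl}(n)}$ of order at least $m$ at $P_+$ and at least $-m-g$ at $P_-$ (and at most simple poles at the $\gamma_s$). Let $\mathcal{A}$ be the algebra of meromorphic functions on $\Gamma$ holomorphic outside $P_\pm$ and $\{A_m\}_{m\in\mathbb{Z}}$ its Krichever–Novikov basis: for $m>0$ or $m<-g$, $A_m$ has order $m$ at $P_+$ and order $-m-g$ at $P_-$; for $-g\le m<0$, $A_m$ has order $m$ at $P_+$ and order $-m-g-1$ at $P_-$; $A_0=1$.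 Then $\mathfrak{g}_m=\mathfrak{gl}(n)_m=\mathfrak{sl}(n)_m\oplus\mathbb{C}A_m\cdot\mathrm{id}$. A 2-cocycle on a Lie algebra is an antisymmetric bilinear form $\chi$ with $\chi([X,Y],Z)+\chi([Y,Z],X)+\chi([Z,X],Y)=0$. A cocycle $\chi$ is local if there are constants $\mu',\mu''$ such that $\chi(\mathfrak{g}_m,\mathfrak{g}_{m'})=0$ unless $\mu'\le m+m'\le\mu''$. *)

theory Defs
  imports
    "HOL-Complex_Analysis.Complex_Analysis"
    "HOL-Homology.Homology"
    "HOL-Algebra.Free_Abelian_Groups"
begin

section \<open>Compact Riemann surfaces\<close>

text \<open>
  The underlying space of the surface is a whole type \<open>'a\<close> with a Hausdorff topology. A chart is
  a pair of its domain and its coordinate map; values of the map outside the domain are irrelevant.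
\<close>

type_synonym 'a chart = "'a set \<times> ('a \<Rightarrow> complex)"

definition chart_inv :: "'a chart \<Rightarrow> complex \<Rightarrow> 'a" where
  "chart_inv c = inv_into (fst c) (snd c)"

definition charts_at :: "'a chart set \<Rightarrow> 'a \<Rightarrow> 'a chart set" where
  "charts_at \<Phi> p = {c \<in> \<Phi>. p \<in> fst c}"

definition complex_atlas :: "('a::topological_space) chart set \<Rightarrow> bool" where
  "complex_atlas \<Phi> \<longleftrightarrow>
     (\<forall>c\<in>\<Phi>. open (fst c) \<and> open (snd c ` fst c) \<and>
        homeomorphism (fst c) (snd c ` fst c) (snd c) (chart_inv c)) \<and>
     (\<Union>c\<in>\<Phi>. fst c) = UNIV \<and>
     (\<forall>c\<in>\<Phi>. \<forall>d\<in>\<Phi>. (\<lambda>z. snd d (chart_inv c z)) holomorphic_on (snd c ` (fst c \<inter> fst d)))"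

definition compact_riemann_surface :: "('a::t2_space) chart set \<Rightarrow> bool" where
  "compact_riemann_surface \<Phi> \<longleftrightarrow>
     complex_atlas \<Phi> \<and> compact (UNIV :: 'a set) \<and> connected (UNIV :: 'a set)"

text \<open>The first integral homology of a compact surface of genus \<open>g\<close> is free abelian of rank \<open>2 g\<close>.\<close>

definition has_genus :: "'a topology \<Rightarrow> nat \<Rightarrow> bool" where
  "has_genus X g \<longleftrightarrow> homology_group 1 X \<cong> free_Abelian_group {..<2 * g}"


section \<open>Meromorphic functions and 1-forms\<close>

definition in_chart :: "'a chart \<Rightarrow> ('a \<Rightarrow> 'b) \<Rightarrow> complex \<Rightarrow> 'b" where
  "in_chart c f = (\<lambda>z. f (chart_inv c z))"

text \<open>
  The Laurent expansion at \<open>p\<close> with respect to the local coordinate \<open>z = snd c - snd c p\<close>, which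
  vanishes at \<open>p\<close>.
\<close>

definition laurent_at :: "'a chart \<Rightarrow> 'a \<Rightarrow> ('a \<Rightarrow> complex) \<Rightarrow> complex fls" where
  "laurent_at c p f = laurent_expansion (in_chart c f) (snd c p)"

definition mat_laurent_coeff ::
    "'a chart \<Rightarrow> 'a \<Rightarrow> ('a \<Rightarrow> complex^'n^'n) \<Rightarrow> int \<Rightarrow> complex^'n^'n" where
  "mat_laurent_coeff c p L k = (\<chi> i j. fls_nth (laurent_at c p (\<lambda>q. L q $ i $ j)) k)"

text \<open>
  Meromorphic functions on the surface that are holomorphic outside \<open>S\<close>. The value of such a
  function at a point of \<open>S\<close> carries no information (there may be a pole), so it is normalised
  to \<open>0\<close>; hence equality in HOL is equality of meromorphic functions.
\<close>

definition meromorphic_fun :: "('a::topological_space) chart set \<Rightarrow> 'a set \<Rightarrow> ('a \<Rightarrow> complex) \<Rightarrow> bool" where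
  "meromorphic_fun \<Phi> S f \<longleftrightarrow>
     (\<forall>c\<in>\<Phi>. in_chart c f analytic_on (snd c ` (fst c - S)) \<and>
             in_chart c f meromorphic_on (snd c ` fst c)) \<and>
     (\<forall>p\<in>S. f p = 0)"

definition order_at_least :: "'a chart set \<Rightarrow> 'a \<Rightarrow> int \<Rightarrow> ('a \<Rightarrow> complex) \<Rightarrow> bool" where
  "order_at_least \<Phi> p m f \<longleftrightarrow>
     (\<forall>c\<in>charts_at \<Phi> p. laurent_at c p f = 0 \<or> m \<le> fls_subdegree (laurent_at c p f))"

definition has_order :: "'a chart set \<Rightarrow> 'a \<Rightarrow> int \<Rightarrow> ('a \<Rightarrow> complex) \<Rightarrow> bool" where
  "has_order \<Phi> p m f \<longleftrightarrow>
     (\<forall>c\<in>charts_at \<Phi> p. laurent_at c p f \<noteq> 0 \<and> fls_subdegree (laurent_at c p f) = m)"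

text \<open>
  A 1-form \<open>\<omega>\<close> is given by its coefficient functions: on the domain of the chart \<open>c\<close> it is
  \<open>\<omega> c\<close> times the differential of the coordinate \<open>snd c\<close>.
  Values of the coefficients on \<open>S\<close> are arbitrary.
\<close>

type_synonym ('a, 'b) form = "'a chart \<Rightarrow> 'a \<Rightarrow> 'b"

definition meromorphic_form ::
    "('a::topological_space) chart set \<Rightarrow> 'a set \<Rightarrow> ('a, complex) form \<Rightarrow> bool" where
  "meromorphic_form \<Phi> S \<omega> \<longleftrightarrow>
     (\<forall>c\<in>\<Phi>. in_chart c (\<omega> c) analytic_on (snd c ` (fst c - S)) \<and>
             in_chart c (\<omega> c) meromorphic_on (snd c ` fst c)) \<and>
     (\<forall>c\<in>\<Phi>. \<forall>d\<in>\<Phi>. \<forall>p \<in> fst c \<inter> fst d - S.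
        \<omega> c p = deriv (\<lambda>z. snd d (chart_inv c z)) (snd c p) * \<omega> d p)"

text \<open>Regularity at \<open>p\<close> of a meromorphic 1-form: it has no pole there.\<close>

definition form_regular_at :: "'a chart set \<Rightarrow> ('a, complex) form \<Rightarrow> 'a \<Rightarrow> bool" where
  "form_regular_at \<Phi> \<omega> p \<longleftrightarrow>
     (\<forall>c\<in>charts_at \<Phi> p. laurent_at c p (\<omega> c) = 0 \<or> 0 \<le> fls_subdegree (laurent_at c p (\<omega> c)))"

text \<open>The residue of a meromorphic 1-form does not depend on the chart in which it is computed.\<close>

definition form_residue :: "'a chart set \<Rightarrow> 'a \<Rightarrow> ('a, complex) form \<Rightarrow> complex" where
  "form_residue \<Phi> p \<omega> =
     (let c = (SOME c. c \<in> charts_at \<Phi> p) in residue (in_chart c (\<omega> c)) (snd c p))"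

definition mat_differential :: "('a \<Rightarrow> complex^'n^'n) \<Rightarrow> ('a, complex^'n^'n) form" where
  "mat_differential L = (\<lambda>c p. \<chi> i j. deriv (in_chart c (\<lambda>q. L q $ i $ j)) (snd c p))"


section \<open>Lax operator algebras\<close>

definition outer_product :: "complex^'n \<Rightarrow> complex^'n \<Rightarrow> complex^'n^'n" where
  "outer_product u v = (\<chi> i j. u $ i * v $ j)"

definition bracket ::
    "('a \<Rightarrow> complex^'n^'n) \<Rightarrow> ('a \<Rightarrow> complex^'n^'n) \<Rightarrow> 'a \<Rightarrow> complex^'n^'n" where
  "bracket X Y = (\<lambda>p. X p ** Y p - Y p ** X p)"

definition singular_points :: "'a \<Rightarrow> 'a \<Rightarrow> nat set \<Rightarrow> (nat \<Rightarrow> 'a) \<Rightarrow> 'a set" where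
  "singular_points Pp Pm I \<gamma> = {Pp, Pm} \<union> \<gamma> ` I"

definition lax_gl ::
    "('a::topological_space) chart set \<Rightarrow> 'a \<Rightarrow> 'a \<Rightarrow> nat set \<Rightarrow> (nat \<Rightarrow> 'a) \<Rightarrow> (nat \<Rightarrow> complex^'n)
      \<Rightarrow> ('a \<Rightarrow> complex^'n^'n) set" where
  "lax_gl \<Phi> Pp Pm I \<gamma> \<alpha> =
     {L. (\<forall>i j. meromorphic_fun \<Phi> (singular_points Pp Pm I \<gamma>) (\<lambda>p. L p $ i $ j)) \<and>
         (\<forall>s\<in>I. \<forall>c\<in>charts_at \<Phi> (\<gamma> s).
            (\<forall>k < -1. mat_laurent_coeff c (\<gamma> s) L k = 0) \<and>
            (\<exists>\<beta>. mat_laurent_coeff c (\<gamma> s) L (-1) = outer_product (\<alpha> s) \<beta> \<and>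
                 scalar_product \<beta> (\<alpha> s) = 0) \<and>
            (\<exists>\<kappa>. mat_laurent_coeff c (\<gamma> s) L 0 *v \<alpha> s = \<kappa> *s \<alpha> s))}"

definition lax_sl ::
    "('a::topological_space) chart set \<Rightarrow> 'a \<Rightarrow> 'a \<Rightarrow> nat set \<Rightarrow> (nat \<Rightarrow> 'a) \<Rightarrow> (nat \<Rightarrow> complex^'n)
      \<Rightarrow> ('a \<Rightarrow> complex^'n^'n) set" where
  "lax_sl \<Phi> Pp Pm I \<gamma> \<alpha> = {L \<in> lax_gl \<Phi> Pp Pm I \<gamma> \<alpha>. \<forall>p. trace (L p) = 0}"

definition lax_sl_homogeneous ::
    "('a::topological_space) chart set \<Rightarrow> nat \<Rightarrow> 'a \<Rightarrow> 'a \<Rightarrow> nat set \<Rightarrow> (nat \<Rightarrow> 'a) \<Rightarrow> (nat \<Rightarrow> complex^'n)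
      \<Rightarrow> int \<Rightarrow> ('a \<Rightarrow> complex^'n^'n) set" where
  "lax_sl_homogeneous \<Phi> g Pp Pm I \<gamma> \<alpha> m =
     {L \<in> lax_sl \<Phi> Pp Pm I \<gamma> \<alpha>.
        \<forall>i j. order_at_least \<Phi> Pp m (\<lambda>p. L p $ i $ j) \<and>
              order_at_least \<Phi> Pm (- m - int g) (\<lambda>p. L p $ i $ j)}"

text \<open>
  The Krichever-Novikov basis. Its existence, with exactly these orders, is what general position
  of the two marked points provides. The value of \<open>A 0\<close> at the marked points is the normalised one.
\<close>

definition kn_basis ::
    "('a::topological_space) chart set \<Rightarrow> nat \<Rightarrow> 'a \<Rightarrow> 'a \<Rightarrow> (int \<Rightarrow> 'a \<Rightarrow> complex) \<Rightarrow> bool" where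
  "kn_basis \<Phi> g Pp Pm A \<longleftrightarrow>
     (\<forall>m. meromorphic_fun \<Phi> {Pp, Pm} (A m)) \<and>
     (\<forall>m. m > 0 \<or> m < - int g \<longrightarrow>
        has_order \<Phi> Pp m (A m) \<and> has_order \<Phi> Pm (- m - int g) (A m)) \<and>
     (\<forall>m. - int g \<le> m \<and> m < 0 \<longrightarrow>
        has_order \<Phi> Pp m (A m) \<and> has_order \<Phi> Pm (- m - int g - 1) (A m)) \<and>
     (\<forall>p. p \<notin> {Pp, Pm} \<longrightarrow> A 0 p = 1) \<and>
     (\<forall>f. meromorphic_fun \<Phi> {Pp, Pm} f \<longrightarrow>
        (\<exists>!a :: int \<Rightarrow> complex. finite {m. a m \<noteq> 0} \<and> f = (\<lambda>p. \<Sum>m | a m \<noteq> 0. a m * A m p)))"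

text \<open>
  The sum of the trace-free part and the multiples of \<open>A m\<close> times the identity. The scalar summand
  is set to \<open>0\<close> at the singular points, as are all elements of the algebra.
\<close>

definition lax_gl_homogeneous ::
    "('a::topological_space) chart set \<Rightarrow> nat \<Rightarrow> 'a \<Rightarrow> 'a \<Rightarrow> nat set \<Rightarrow> (nat \<Rightarrow> 'a) \<Rightarrow> (nat \<Rightarrow> complex^'n)
      \<Rightarrow> (int \<Rightarrow> 'a \<Rightarrow> complex) \<Rightarrow> int \<Rightarrow> ('a \<Rightarrow> complex^'n^'n) set" where
  "lax_gl_homogeneous \<Phi> g Pp Pm I \<gamma> \<alpha> A m =
     {(\<lambda>p. X p + (if p \<in> singular_points Pp Pm I \<gamma> then 0 else mat (a * A m p))) | X a.
        X \<in> lax_sl_homogeneous \<Phi> g Pp Pm I \<gamma> \<alpha> m}"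


section \<open>Cocycles\<close>

text \<open>
  Here \<open>V\<close> is a complex Lie algebra of matrix-valued functions, with pointwise operations; note
  that \<open>mat a ** X p\<close> is the scalar multiple of the matrix \<open>X p\<close> by \<open>a\<close>.
\<close>

definition two_cocycle ::
    "('a \<Rightarrow> complex^'n^'n) set
      \<Rightarrow> (('a \<Rightarrow> complex^'n^'n) \<Rightarrow> ('a \<Rightarrow> complex^'n^'n) \<Rightarrow> complex) \<Rightarrow> bool" where
  "two_cocycle V \<psi> \<longleftrightarrow>
     (\<forall>X\<in>V. \<forall>Y\<in>V. \<forall>Z\<in>V.
        \<psi> (\<lambda>p. X p + Y p) Z = \<psi> X Z + \<psi> Y Z \<and> \<psi> Z (\<lambda>p. X p + Y p) = \<psi> Z X + \<psi> Z Y) \<and>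
     (\<forall>a. \<forall>X\<in>V. \<forall>Y\<in>V.
        \<psi> (\<lambda>p. mat a ** X p) Y = a * \<psi> X Y \<and> \<psi> X (\<lambda>p. mat a ** Y p) = a * \<psi> X Y) \<and>
     (\<forall>X\<in>V. \<forall>Y\<in>V. \<psi> X Y = - \<psi> Y X) \<and>
     (\<forall>X\<in>V. \<forall>Y\<in>V. \<forall>Z\<in>V.
        \<psi> (bracket X Y) Z + \<psi> (bracket Y Z) X + \<psi> (bracket Z X) Y = 0)"

definition local_wrt ::
    "(int \<Rightarrow> ('a \<Rightarrow> complex^'n^'n) set)
      \<Rightarrow> (('a \<Rightarrow> complex^'n^'n) \<Rightarrow> ('a \<Rightarrow> complex^'n^'n) \<Rightarrow> complex) \<Rightarrow> bool" where
  "local_wrt G \<psi> \<longleftrightarrow>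
     (\<exists>\<mu>1 \<mu>2 :: int. \<forall>m m'. \<not> (\<mu>1 \<le> m + m' \<and> m + m' \<le> \<mu>2) \<longrightarrow>
        (\<forall>X\<in>G m. \<forall>Y\<in>G m'. \<psi> X Y = 0))"

text \<open>The matrix-valued 1-forms used to define the cocycle.\<close>

definition lax_form ::
    "('a::topological_space) chart set \<Rightarrow> 'a \<Rightarrow> 'a \<Rightarrow> nat set \<Rightarrow> (nat \<Rightarrow> 'a) \<Rightarrow> (nat \<Rightarrow> complex^'n)
      \<Rightarrow> ('a, complex^'n^'n) form \<Rightarrow> bool" where
  "lax_form \<Phi> Pp Pm I \<gamma> \<alpha> \<Omega> \<longleftrightarrow>
     (\<forall>i j. meromorphic_form \<Phi> (singular_points Pp Pm I \<gamma>) (\<lambda>c p. \<Omega> c p $ i $ j)) \<and>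
     (\<forall>s\<in>I. \<forall>c\<in>charts_at \<Phi> (\<gamma> s).
        (\<forall>k < -1. mat_laurent_coeff c (\<gamma> s) (\<Omega> c) k = 0) \<and>
        (\<exists>\<beta>. mat_laurent_coeff c (\<gamma> s) (\<Omega> c) (-1) = outer_product (\<alpha> s) \<beta> \<and>
             scalar_product \<beta> (\<alpha> s) = 1) \<and>
        (\<exists>\<kappa>. mat_laurent_coeff c (\<gamma> s) (\<Omega> c) 0 *v \<alpha> s = \<kappa> *s \<alpha> s))"

text \<open>The 1-form \<open>tr (L dL' - [L, L'] \<Omega>)\<close>.\<close>

definition cocycle_form ::
    "('a, complex^'n^'n) form \<Rightarrow> ('a \<Rightarrow> complex^'n^'n) \<Rightarrow> ('a \<Rightarrow> complex^'n^'n) \<Rightarrow> ('a, complex) form"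
  where
  "cocycle_form \<Omega> L L' =
     (\<lambda>c p. trace (L p ** mat_differential L' c p - bracket L L' p ** \<Omega> c p))"

end

theory Submission
  imports Defs
begin

text \<open>
  Everything except locality is a computation with Laurent series in one chart. The sum of
  \<open>tr (L dL')\<close> and \<open>tr (L' dL)\<close>, and the cyclic sum of \<open>tr ([X, Y] dZ)\<close>, are exact and so have no
  residue, while \<open>tr ([[X, Y], Z] \<Omega>)\<close> drops out by the Jacobi identity.

  If \<open>m + m'\<close> is large, the form is regular at \<open>P\<^sub>+\<close> by counting orders. If it is very negative,
  the form is regular at \<open>P\<^sub>-\<close>, so \<open>P\<^sub>+\<close> is its only pole, and the residue there has to vanish. This
  case of the residue theorem is proved by pushing the form \<open>\<omega>\<close> forward along a Krichever-Novikov
  function \<open>F\<close> whose only pole is at \<open>P\<^sub>+\<close>, of at least the order of the pole of \<open>\<omega>\<close>: the function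
  \<open>T(w)\<close>, the sum of the residues of \<open>\<omega> / (F - w)\<close> outside \<open>P\<^sub>+\<close>, is entire, because locally it is a
  sum of integrals over fixed circles, and for large \<open>w\<close> it is a single such integral around \<open>P\<^sub>+\<close>,
  which tends to \<open>0\<close>. So \<open>T = 0\<close> by Liouville's theorem. For large \<open>w\<close> the integral of \<open>\<omega>\<close> around
  \<open>P\<^sub>+\<close> then equals the integral of \<open>F \<omega> / (F - w)\<close>, which also tends to \<open>0\<close>.
\<close>

(* The unqualified bundle name denotes the one of Formal_Laurent_Series, which does not free $. *)
unbundle no Formal_Power_Series.fps_syntax

section \<open>Residues under a change of coordinate\<close>

text \<open>The chain rule is known for power series, and a power of X clears the pole of
  \<open>F\<close>. Differentiating \<open>F * X^n = A\<close> before and after the substitution of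
  \<open>H\<close>, and cancelling the substituted power of X, transfers the rule to
  \<open>F\<close>.\<close>

lemma fls_deriv_compose_fps:
  fixes F :: "complex fls"
  assumes H: "H \<noteq> 0" "fps_nth H 0 = 0"
  shows "fls_deriv (fls_compose_fps F H) = fls_compose_fps (fls_deriv F) H * fps_to_fls (fps_deriv H)"
proof -
  have fps: "fls_deriv (fls_compose_fps (fps_to_fls P) H) =
      fls_compose_fps (fls_deriv (fps_to_fls P)) H * fps_to_fls (fps_deriv H)" for P
    using H by (simp add: fls_deriv_fps_to_fls fps_compose_deriv fls_times_fps_to_fls)
  \<comment> \<open>The order of the pole of \<open>F\<close>, or 0 if there is none, so that
    \<open>F\<close> times \<open>fps_X ^ n\<close> is a power series.\<close>
  define n where "n = nat (- fls_subdegree F)"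
  define A where "A = fls_regpart (fls_shift (- int n) F)"
  define B :: "complex fps" where "B = fps_X ^ n"
  have A: "fps_to_fls A = fls_shift (- int n) F"
    unfolding A_def by (cases "F = 0") (auto intro!: fls_regpart_to_fls_trivial simp: n_def)
  have FB: "F * fps_to_fls B = fps_to_fls A"
    unfolding A B_def by (simp add: fps_to_fls_power fls_X_power_times_conv_shift)
  have B: "fps_to_fls B \<noteq> 0" by (simp add: B_def)
  let ?c = "\<lambda>G. fls_compose_fps G H"
  have 1: "?c F * ?c (fps_to_fls B) = ?c (fps_to_fls A)"
    using H by (metis FB fls_compose_fps_mult)
  have 2: "fls_deriv F * fps_to_fls B + F * fls_deriv (fps_to_fls B) = fls_deriv (fps_to_fls A)"
    using arg_cong[OF FB, of fls_deriv] by (simp add: algebra_simps)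
  have "fls_deriv (?c F) * ?c (fps_to_fls B) + ?c F * fls_deriv (?c (fps_to_fls B))
      = fls_deriv (?c (fps_to_fls A))"
    using arg_cong[OF 1, of fls_deriv] by (simp only: fls_deriv_mult) (simp add: algebra_simps)
  also have "\<dots> = ?c (fls_deriv F * fps_to_fls B + F * fls_deriv (fps_to_fls B)) * fps_to_fls (fps_deriv H)"
    by (simp only: fps 2)
  also have "\<dots> = (?c (fls_deriv F) * ?c (fps_to_fls B) + ?c F * ?c (fls_deriv (fps_to_fls B))) * fps_to_fls (fps_deriv H)"
    by (simp only: fls_compose_fps_mult[OF H] fls_compose_fps_add[OF H])
  finally have "fls_deriv (?c F) * ?c (fps_to_fls B) = ?c (fls_deriv F) * fps_to_fls (fps_deriv H) * ?c (fps_to_fls B)"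
    by (simp only: fps) (simp add: algebra_simps)
  moreover have "?c (fps_to_fls B) \<noteq> 0"
    using B H by (simp add: fls_compose_fps_eq_0_iff del: fls_compose_fps_to_fls)
  ultimately show ?thesis by simp
qed

text \<open>The residue sits in the term \<open>r / X\<close>, and the rest of \<open>F\<close> is a
  derivative \<open>K'\<close>. Substitution keeps the derivative part exact by the chain rule and
  turns \<open>r / X\<close> into \<open>r * H' / H\<close>, whose residue is \<open>r\<close> times
  the order 1 of \<open>H\<close>.\<close>

lemma fls_residue_compose_fps:
  fixes F :: "complex fls"
  assumes H: "fps_nth H 0 = 0" "fps_nth H 1 \<noteq> 0"
  shows "fls_residue (fls_compose_fps F H * fps_to_fls (fps_deriv H)) = fls_residue F"
proof -
  from H have H0: "H \<noteq> 0" by auto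
  have sd: "subdegree H = 1" using H by (intro subdegreeI) (auto simp: less_Suc_eq)
  define r where "r = fls_residue F"
  have "fls_residue (F - fls_const r * inverse fls_X) = 0"
    by (simp add: r_def fls_inverse_X)
  then obtain K where K: "fls_deriv K = F - fls_const r * inverse fls_X"
    using fls_residue_nonzero_ex_antiderivative by blast
  then have F: "F = fls_const r * inverse fls_X + fls_deriv K" by simp
  have "fls_compose_fps F H * fps_to_fls (fps_deriv H) =
      fls_const r * (fls_deriv (fps_to_fls H) * inverse (fps_to_fls H)) + fls_deriv (fls_compose_fps K H)"
    using H H0 unfolding F
    by (simp add: fls_compose_fps_add fls_compose_fps_mult fls_compose_fps_inverse
        fls_deriv_compose_fps fls_deriv_fps_to_fls algebra_simps)
  then have "fls_residue (fls_compose_fps F H * fps_to_fls (fps_deriv H)) =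
     fls_residue (fls_const r * (fls_deriv (fps_to_fls H) * inverse (fps_to_fls H)))"
    by (simp only: fls_residue_add fls_residue_deriv) simp
  also have "\<dots> = r * of_int (fls_subdegree (fps_to_fls H))"
    by (simp only: fls_residue_fls_const_times fls_residue_deriv_times_inverse_eq_subdegree)
  also have "\<dots> = r" by (simp add: fls_subdegree_fls_to_fps sd)
  finally show ?thesis by (simp add: r_def)
qed

section \<open>Change of variable in residues of meromorphic functions\<close>

lemma eventually_analytic_at:
  assumes "f analytic_on {a}"
  shows "\<forall>\<^sub>F z in nhds a. f analytic_on {z}"
proof -
  obtain S where S: "open S" "a \<in> S" "f holomorphic_on S"
    using assms by (auto simp: analytic_at)
  then have "\<forall>\<^sub>F z in nhds a. z \<in> S" by (intro eventually_nhds_in_open)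
  then show ?thesis using S by (auto elim!: eventually_mono intro: holomorphic_on_imp_analytic_at)
qed

lemma residue_compose:
  assumes f: "f meromorphic_on {\<phi> a}" and \<phi>: "\<phi> analytic_on {a}" "deriv \<phi> a \<noteq> 0"
  shows "residue (\<lambda>z. deriv \<phi> z * f (\<phi> z)) a = residue f (\<phi> a)"
proof -
  obtain F where F: "(\<lambda>w. f (\<phi> a + w)) has_laurent_expansion F"
    using f by (auto simp: meromorphic_on_def)
  have "(\<lambda>z. \<phi> z - \<phi> a) analytic_on {a}" using \<phi> by (intro analytic_intros)
  then obtain H where H: "(\<lambda>w. \<phi> (a + w) - \<phi> a) has_fps_expansion H"
    using analytic_at_imp_has_fps_expansion by blast
  have H0: "fps_nth H 0 = 0"
    using has_fps_expansion_imp_0_eq_fps_nth_0[OF H] by simp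
  have dH: "deriv (\<lambda>w. \<phi> (a + w) - \<phi> a) has_fps_expansion fps_deriv H"
    using H by (rule has_fps_expansion_deriv)
  \<comment> \<open>The expansion above belongs to the derivative of the shifted map. Near 0 this is
    the shifted derivative, because \<phi> is analytic throughout a neighbourhood of
    \<open>a\<close>.\<close>
  have deq: "\<forall>\<^sub>F w in nhds 0. deriv (\<lambda>w. \<phi> (a + w) - \<phi> a) w = deriv \<phi> (a + w)"
  proof -
    have "\<forall>\<^sub>F z in nhds a. \<phi> analytic_on {z}" using \<phi>(1) by (rule eventually_analytic_at)
    moreover have "filterlim (\<lambda>w. a + w) (nhds a) (nhds 0)"
      using tendsto_add[OF tendsto_const[of a] filterlim_ident[of "nhds 0"]] by simp
    ultimately have "\<forall>\<^sub>F w in nhds 0. \<phi> analytic_on {a + w}"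
      by (rule eventually_compose_filterlim)
    then show ?thesis
    proof eventually_elim
      case (elim w)
      then have "(\<phi> has_field_derivative deriv \<phi> (a + w)) (at (a + w))"
        using analytic_on_imp_differentiable_at DERIV_deriv_iff_field_differentiable by blast
      then have "((\<lambda>w. \<phi> (a + w) - \<phi> a) has_field_derivative deriv \<phi> (a + w)) (at w)"
        using DERIV_shift[of \<phi> "deriv \<phi> (a + w)" w a] DERIV_diff[OF _ DERIV_const[of "\<phi> a"], of "\<lambda>w. \<phi> (a + w)"]
        by (simp add: add.commute)
      then show ?case by (rule DERIV_imp_deriv)
    qed
  qed
  have dH': "(\<lambda>w. deriv \<phi> (a + w)) has_fps_expansion fps_deriv H"
    using dH has_fps_expansion_cong[OF deq refl] by blast
  have "fps_nth (fps_deriv H) 0 = deriv \<phi> a"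
    using has_fps_expansion_imp_0_eq_fps_nth_0[OF dH'] by simp
  then have H1: "fps_nth H 1 \<noteq> 0" using \<phi>(2) by simp
  then have "H \<noteq> 0" by auto
  have "((\<lambda>w. f (\<phi> a + w)) \<circ> (\<lambda>w. \<phi> (a + w) - \<phi> a)) has_laurent_expansion fls_compose_fps F H"
    using has_laurent_expansion_compose[OF F has_laurent_expansion_fps[OF H] H0 \<open>H \<noteq> 0\<close>] .
  then have "(\<lambda>w. f (\<phi> (a + w))) has_laurent_expansion fls_compose_fps F H"
    by (simp add: o_def)
  from has_laurent_expansion_mult[OF this has_laurent_expansion_fps[OF dH']]
  have "(\<lambda>w. deriv \<phi> (a + w) * f (\<phi> (a + w))) has_laurent_expansion fls_compose_fps F H * fps_to_fls (fps_deriv H)"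
    by (simp add: mult.commute)
  then have "residue (\<lambda>z. deriv \<phi> z * f (\<phi> z)) a = fls_residue (fls_compose_fps F H * fps_to_fls (fps_deriv H))"
    by (rule has_laurent_expansion_residue)
  also have "\<dots> = fls_residue F" using H0 H1 by (rule fls_residue_compose_fps)
  also have "\<dots> = residue f (\<phi> a)" using has_laurent_expansion_residue[OF F] by simp
  finally show ?thesis .
qed

section \<open>Charts and integrals over circles\<close>

locale charted_surface =
  fixes \<Phi> :: "('a::t2_space) chart set"
  assumes atlas: "complex_atlas \<Phi>"
begin

lemma open_chart_domain: "c \<in> \<Phi> \<Longrightarrow> open (fst c)"
  and open_chart_image: "c \<in> \<Phi> \<Longrightarrow> open (snd c ` fst c)"
  and homeomorphism_chart: "c \<in> \<Phi> \<Longrightarrow> homeomorphism (fst c) (snd c ` fst c) (snd c) (chart_inv c)"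
  and transition_holomorphic: "c \<in> \<Phi> \<Longrightarrow> d \<in> \<Phi> \<Longrightarrow>
     (\<lambda>z. snd d (chart_inv c z)) holomorphic_on (snd c ` (fst c \<inter> fst d))"
  using atlas by (auto simp: complex_atlas_def)

lemma charts_at_nonempty: "charts_at \<Phi> p \<noteq> {}"
proof -
  have "p \<in> (\<Union>c\<in>\<Phi>. fst c)" using atlas by (simp add: complex_atlas_def)
  then show ?thesis by (auto simp: charts_at_def)
qed

lemma chart_inv_chart [simp]: "c \<in> \<Phi> \<Longrightarrow> p \<in> fst c \<Longrightarrow> chart_inv c (snd c p) = p"
  and chart_chart_inv [simp]: "c \<in> \<Phi> \<Longrightarrow> z \<in> snd c ` fst c \<Longrightarrow> snd c (chart_inv c z) = z"
  and chart_inv_in [simp]: "c \<in> \<Phi> \<Longrightarrow> z \<in> snd c ` fst c \<Longrightarrow> chart_inv c z \<in> fst c"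
  using homeomorphism_chart[of c] by (auto simp: homeomorphism_def)

lemma inj_on_chart_inv: "c \<in> \<Phi> \<Longrightarrow> inj_on (chart_inv c) (snd c ` fst c)"
  by (metis chart_chart_inv inj_onI)

lemma isCont_chart: "c \<in> \<Phi> \<Longrightarrow> p \<in> fst c \<Longrightarrow> isCont (snd c) p"
  using homeomorphism_chart[of c] open_chart_domain[of c]
  by (auto simp: homeomorphism_def continuous_on_eq_continuous_at)

lemma isCont_chart_inv: "c \<in> \<Phi> \<Longrightarrow> z \<in> snd c ` fst c \<Longrightarrow> isCont (chart_inv c) z"
  using homeomorphism_chart[of c] open_chart_image[of c]
  by (auto simp: homeomorphism_def continuous_on_eq_continuous_at)

lemma eventually_at_chart_image:
  assumes "c \<in> \<Phi>" "p \<in> fst c"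
  shows "\<forall>\<^sub>F z in at (snd c p). z \<in> snd c ` fst c"
  using assms open_chart_image by (intro eventually_at_in_open') auto

text \<open>Charts are homeomorphisms between open sets, so punctured neighbourhoods correspond.
  This carries statements about points close to \<open>p\<close> into the complex plane and
  back.\<close>

lemma eventually_at_chart:
  assumes c: "c \<in> \<Phi>" "p \<in> fst c"
  shows "(\<forall>\<^sub>F x in at p. P x) \<longleftrightarrow> (\<forall>\<^sub>F z in at (snd c p). P (chart_inv c z))"
proof
  have ev: "\<forall>\<^sub>F x in at p. x \<in> fst c \<and> x \<noteq> p"
    using c open_chart_domain[of c] by (auto simp: eventually_conj_iff eventually_neq_at_within intro!: eventually_at_in_open')
  have ev': "\<forall>\<^sub>F z in at (snd c p). z \<in> snd c ` fst c \<and> z \<noteq> snd c p"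
    using eventually_at_chart_image[OF c] by (auto simp: eventually_conj_iff eventually_neq_at_within)
  show "\<forall>\<^sub>F z in at (snd c p). P (chart_inv c z)" if "\<forall>\<^sub>F x in at p. P x"
  proof -
    have "filterlim (chart_inv c) (at p) (at (snd c p))"
      using isCont_chart_inv[OF c(1), of "snd c p"] c ev'
      by (auto simp: filterlim_at isCont_def elim!: eventually_mono) 
    with that show ?thesis by (rule eventually_compose_filterlim)
  qed
  show "\<forall>\<^sub>F x in at p. P x" if "\<forall>\<^sub>F z in at (snd c p). P (chart_inv c z)"
  proof -
    have "filterlim (snd c) (at (snd c p)) (at p)"
      using isCont_chart[OF c] ev c
      by (auto simp: filterlim_at isCont_def elim!: eventually_mono dest!: arg_cong[of _ _ "chart_inv c"])
    with that have "\<forall>\<^sub>F x in at p. P (chart_inv c (snd c x))" by (rule eventually_compose_filterlim)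
    with ev show ?thesis by eventually_elim (use c in auto)
  qed
qed

text \<open>The plane has no isolated points, hence neither has the surface. So a property and its
  negation cannot both hold eventually near \<open>p\<close>.\<close>

lemma at_surface_neq_bot: "at (p::'a) \<noteq> bot"
proof -
  obtain c where c: "c \<in> \<Phi>" "p \<in> fst c"
    using charts_at_nonempty[of p] by (auto simp: charts_at_def)
  then show ?thesis
    using eventually_at_chart[OF c, of "\<lambda>_. False"] trivial_limit_at[of "snd c p"]
    by (simp add: eventually_False)
qed

text \<open>The transition function is injective on an open set, and an injective holomorphic
  function on an open set has no critical points.\<close>

lemma transition_regular:
  assumes c: "c \<in> \<Phi>" "p \<in> fst c" and d: "d \<in> \<Phi>" "p \<in> fst d"
  shows "(\<lambda>z. snd d (chart_inv c z)) analytic_on {snd c p}"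
    and "deriv (\<lambda>z. snd d (chart_inv c z)) (snd c p) \<noteq> 0"
proof -
  define \<phi> where "\<phi> = (\<lambda>z. snd d (chart_inv c z))"
  have "continuous_on (snd c ` fst c) (chart_inv c)"
    using homeomorphism_chart[OF c(1)] by (simp add: homeomorphism_def)
  then have "open (chart_inv c -` fst d \<inter> snd c ` fst c)"
    using open_chart_image[OF c(1)] open_chart_domain[OF d(1)] by (simp add: continuous_on_open_vimage)
  moreover have "chart_inv c -` fst d \<inter> snd c ` fst c = snd c ` (fst c \<inter> fst d)"
    using c(1) by auto
  ultimately have op: "open (snd c ` (fst c \<inter> fst d))" by simp
  have hol: "\<phi> holomorphic_on snd c ` (fst c \<inter> fst d)"
    unfolding \<phi>_def using c d by (intro transition_holomorphic)
  have inj: "inj_on \<phi> (snd c ` (fst c \<inter> fst d))"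
    using c(1) d(1) by (auto simp: inj_on_def \<phi>_def) (metis chart_inv_chart)
  show "\<phi> analytic_on {snd c p}"
    using hol op c d by (intro holomorphic_on_imp_analytic_at) auto
  show "deriv \<phi> (snd c p) \<noteq> 0"
    using holomorphic_injective_imp_regular[OF hol op inj] c d by auto
qed

text \<open>Here \<open>h\<close> and \<open>k\<close> are the coefficients of one form in the
  charts \<open>c\<close> and \<open>d\<close>. The transformation rule is asked for on a punctured
  neighbourhood only, as the coefficients may be arbitrary at \<open>p\<close> itself.\<close>

lemma residue_chart_independent:
  assumes c: "c \<in> \<Phi>" "p \<in> fst c" and d: "d \<in> \<Phi>" "p \<in> fst d"
    and eq: "\<forall>\<^sub>F x in at p. h x = deriv (\<lambda>z. snd d (chart_inv c z)) (snd c x) * k x"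
    and mero: "in_chart d k meromorphic_on {snd d p}"
  shows "residue (in_chart c h) (snd c p) = residue (in_chart d k) (snd d p)"
proof -
  define \<phi> where "\<phi> = (\<lambda>z. snd d (chart_inv c z))"
  have \<phi>p: "\<phi> (snd c p) = snd d p" using c by (simp add: \<phi>_def)
  have "\<forall>\<^sub>F x in at p. x \<in> fst d"
    using d open_chart_domain[of d] by (intro eventually_at_in_open') auto
  with eq have "\<forall>\<^sub>F x in at p. x \<in> fst d \<and> h x = deriv \<phi> (snd c x) * k x"
    by eventually_elim (auto simp: \<phi>_def)
  then have ev: "\<forall>\<^sub>F z in at (snd c p). chart_inv c z \<in> fst d \<and>
      h (chart_inv c z) = deriv \<phi> (snd c (chart_inv c z)) * k (chart_inv c z)"
    by (subst (asm) eventually_at_chart[OF c])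
  have "residue (in_chart c h) (snd c p) = residue (\<lambda>z. deriv \<phi> z * in_chart d k (\<phi> z)) (snd c p)"
  proof (rule residue_cong)
    show "\<forall>\<^sub>F z in at (snd c p). in_chart c h z = deriv \<phi> z * in_chart d k (\<phi> z)"
      using ev eventually_at_chart_image[OF c]
      by eventually_elim (use c d in \<open>auto simp: in_chart_def \<phi>_def\<close>)
  qed simp
  also have "\<dots> = residue (in_chart d k) (\<phi> (snd c p))"
    using mero transition_regular[OF c d] unfolding \<phi>p[symmetric] by (intro residue_compose) (auto simp: \<phi>_def)
  finally show ?thesis by (simp add: \<phi>p)
qed

text \<open>The radius is doubled so that the circle of radius \<open>r\<close> and its closed disc
  lie inside an open disc on which \<open>Q\<close> is controlled away from the centre.\<close>

lemma chart_disc: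
  assumes c: "c \<in> \<Phi>" "p \<in> fst c" and Q: "\<forall>\<^sub>F x in at p. Q x"
  shows "\<exists>r>0. ball (snd c p) (2 * r) \<subseteq> snd c ` fst c \<and>
    (\<forall>z\<in>ball (snd c p) (2 * r) - {snd c p}. Q (chart_inv c z))"
proof -
  have "\<forall>\<^sub>F z in at (snd c p). z \<in> snd c ` fst c \<and> Q (chart_inv c z)"
    using Q eventually_at_chart_image[OF c] by (simp add: eventually_at_chart[OF c] eventually_conj_iff)
  then obtain d where d: "d > 0"
    "\<And>z. z \<noteq> snd c p \<Longrightarrow> dist z (snd c p) < d \<Longrightarrow> z \<in> snd c ` fst c \<and> Q (chart_inv c z)"
    by (auto simp: eventually_at)
  then show ?thesis
    using c by (intro exI[of _ "d / 2"]) (force simp: dist_commute)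
qed

lemma open_chart_inv_image:
  assumes "c \<in> \<Phi>" "open U" "U \<subseteq> snd c ` fst c"
  shows "open (chart_inv c ` U)"
proof -
  have "continuous_on (fst c) (snd c)"
    using homeomorphism_chart[OF assms(1)] by (simp add: homeomorphism_def)
  then have "open (snd c -` U \<inter> fst c)"
    using assms open_chart_domain by (simp add: continuous_on_open_vimage)
  moreover have "snd c -` U \<inter> fst c = chart_inv c ` U"
  proof (intro equalityI subsetI)
    fix x assume "x \<in> snd c -` U \<inter> fst c"
    then show "x \<in> chart_inv c ` U" using assms(1) by (intro image_eqI[of _ _ "snd c x"]) auto
  next
    fix x assume "x \<in> chart_inv c ` U"
    then obtain u where u: "u \<in> U" "x = chart_inv c u" by auto
    then have "u \<in> snd c ` fst c" using assms(3) by auto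
    with u assms(1) show "x \<in> snd c -` U \<inter> fst c" by simp
  qed
  ultimately show ?thesis by simp
qed

end

section \<open>Separation of finitely many points; circle integrals with a parameter\<close>

lemma finite_disjoint_open_nhds:
  assumes "finite (K :: 'a::t2_space set)"
  obtains V where "\<And>x. x \<in> K \<Longrightarrow> open (V x)" "\<And>x. x \<in> K \<Longrightarrow> x \<in> V x" "disjoint_family_on V K"
proof -
  define P where "P x y U W \<longleftrightarrow> open U \<and> open W \<and> x \<in> U \<and> y \<in> W \<and> U \<inter> W = {}" for x y :: 'a and U W
  have "\<exists>UW. x \<noteq> y \<longrightarrow> P x y (fst UW) (snd UW)" for x y
    unfolding P_def using hausdorff[of x y] by (cases "x = y") auto
  then obtain UW where UW: "\<And>x y. x \<noteq> y \<Longrightarrow> P x y (fst (UW x y)) (snd (UW x y))"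
    by metis
  define U where "U x y = fst (UW x y)" for x y
  define W where "W x y = snd (UW x y)" for x y
  have UW: "open (U x y)" "open (W x y)" "x \<in> U x y" "y \<in> W x y" "U x y \<inter> W x y = {}" if "x \<noteq> y" for x y
    using UW[OF that] by (auto simp: P_def U_def W_def)
  \<comment> \<open>The separations chosen for \<open>(x, y)\<close> and \<open>(y, x)\<close> are
    unrelated. Taking both \<open>U x y\<close> and \<open>W y x\<close> puts \<open>V x\<close>
    into \<open>U x y\<close> and \<open>V y\<close> into the disjoint set
    \<open>W x y\<close>.\<close>
  define V where "V x = (\<Inter>y\<in>K - {x}. U x y \<inter> W y x)" for x
  show ?thesis
  proof (rule that[of V])
    show "open (V x)" if "x \<in> K" for x
      unfolding V_def using assms UW(1,2) by (intro open_INT) (auto intro!: open_Int)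
    show "x \<in> V x" if "x \<in> K" for x
      unfolding V_def by (intro INT_I IntI UW(3,4)) auto
    show "disjoint_family_on V K"
      unfolding disjoint_family_on_def
    proof (intro ballI impI)
      fix x y assume xy: "x \<in> K" "y \<in> K" "x \<noteq> y"
      then have "V x \<subseteq> U x y" "V y \<subseteq> W x y" by (auto simp: V_def)
      with UW(5)[OF xy(3)] show "V x \<inter> V y = {}" by auto
    qed
  qed
qed

text \<open>Differentiation under the integral sign: the integrand is holomorphic in
  \<open>w\<close> because \<open>G - w\<close> has no zero on the circle. The Leibniz rule is
  applied on a convex set, later a ball.\<close>

lemma contour_integral_quotient_holomorphic:
  fixes f G :: "complex \<Rightarrow> complex"
  assumes r: "r > 0" and f: "continuous_on (sphere a r) f" and G: "continuous_on (sphere a r) G"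
    and U: "convex U" and ne: "\<And>w z. w \<in> U \<Longrightarrow> z \<in> sphere a r \<Longrightarrow> G z \<noteq> w"
  shows "(\<lambda>w. contour_integral (circlepath a r) (\<lambda>z. f z / (G z - w))) holomorphic_on U"
proof -
  let ?g = "circlepath a r"
  \<comment> \<open>The derivative of the parametrization of the circle.\<close>
  define D where "D t = 2 * pi * \<i> * r * exp (2 * of_real pi * \<i> * t)" for t :: real
  have g: "?g t \<in> sphere a r" for t
    using r by (simp add: circlepath dist_norm norm_mult)
  have cg: "continuous_on {0..1} ?g" 
    using path_def valid_path_imp_path valid_path_circlepath by blast
  have cfg: "continuous_on {0..1} (\<lambda>t. f (?g t))" "continuous_on {0..1} (\<lambda>t. G (?g t))"
    using continuous_on_compose2[OF f cg] continuous_on_compose2[OF G cg] g by blast+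
  have cfg2: "continuous_on (U \<times> {0..1}) (\<lambda>x. f (?g (snd x)))" "continuous_on (U \<times> {0..1}) (\<lambda>x. G (?g (snd x)))"
    using cfg by (auto intro!: continuous_on_compose2[OF _ continuous_on_snd[OF continuous_on_id]])
  have cD: "continuous_on A D" for A
    unfolding D_def by (intro continuous_intros)
  have "(\<lambda>w. integral (cbox 0 1) (\<lambda>t. f (?g t) / (G (?g t) - w) * D t)) holomorphic_on U"
  proof (rule leibniz_rule_holomorphic[OF _ _ _ U])
    show "((\<lambda>w. f (?g t) / (G (?g t) - w) * D t) has_field_derivative
        f (?g t) * D t / (G (?g t) - w)^2) (at w within U)" if "w \<in> U" "t \<in> cbox 0 1" for w t
      using ne[OF that(1) g, of t] by (auto intro!: derivative_eq_intros simp: power2_eq_square field_simps)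
    show "(\<lambda>t. f (?g t) / (G (?g t) - w) * D t) integrable_on cbox 0 1" if "w \<in> U" for w
      using ne[OF that g] cfg cD by (intro integrable_continuous) (auto intro!: continuous_intros)
    show "continuous_on (U \<times> cbox 0 1) (\<lambda>(w, t). f (?g t) * D t / (G (?g t) - w)^2)"
      using ne[OF _ g] cfg2 unfolding case_prod_unfold
      by (auto intro!: continuous_intros continuous_on_compose2[OF cD])
  qed
  moreover have "contour_integral ?g (\<lambda>z. f z / (G z - w)) =
      integral (cbox 0 1) (\<lambda>t. f (?g t) / (G (?g t) - w) * D t)" for w
    unfolding contour_integral_integral
    by (auto intro!: integral_cong simp: D_def vector_derivative_circlepath cbox_interval)
  ultimately show ?thesis by simp
qed

text \<open>If \<open>G\<close> is bounded by \<open>M\<close> on the circle, then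
  \<open>norm (G z - w)\<close> is at least \<open>norm w / 2\<close> for large \<open>w\<close>, so
  the integral decays like \<open>1 / norm w\<close>.\<close>

lemma contour_integral_quotient_tendsto_0:
  fixes f G :: "complex \<Rightarrow> complex"
  assumes r: "r > 0" and f: "continuous_on (sphere a r) f" and G: "continuous_on (sphere a r) G"
  shows "((\<lambda>w. contour_integral (circlepath a r) (\<lambda>z. f z / (G z - w))) \<longlongrightarrow> 0) at_infinity"
proof -
  have "bounded (f ` sphere a r)" "bounded (G ` sphere a r)"
    using f G by (auto intro!: compact_imp_bounded compact_continuous_image)
  then obtain A M where A: "A > 0" "\<And>z. z \<in> sphere a r \<Longrightarrow> norm (f z) \<le> A"
    and M: "M > 0" "\<And>z. z \<in> sphere a r \<Longrightarrow> norm (G z) \<le> M"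
    unfolding bounded_pos by auto
  show ?thesis
  proof (rule Lim_null_comparison)
    show "\<forall>\<^sub>F w in at_infinity. norm (contour_integral (circlepath a r) (\<lambda>z. f z / (G z - w)))
        \<le> (2 * A * (2 * pi * r)) * norm (inverse w)"
      unfolding eventually_at_infinity
    proof (intro exI[of _ "2 * M + 1"] allI impI)
      fix w :: complex assume w: "2 * M + 1 \<le> norm w"
      have low: "norm w / 2 \<le> norm (G z - w)" if "z \<in> sphere a r" for z
        using norm_triangle_ineq2[of w "G z"] M(2)[OF that] w by (simp add: norm_minus_commute)
      have wpos: "norm w > 0" using w M by linarith
      have ne: "G z \<noteq> w" if "z \<in> sphere a r" for z
        using low[OF that] wpos by auto
      have "norm (contour_integral (circlepath a r) (\<lambda>z. f z / (G z - w))) \<le> (2 * A / norm w) * (2 * pi * r)"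
      proof (rule has_contour_integral_bound_circlepath)
        show "((\<lambda>z. f z / (G z - w)) has_contour_integral
           contour_integral (circlepath a r) (\<lambda>z. f z / (G z - w))) (circlepath a r)"
          using f G ne r by (intro has_contour_integral_integral contour_integrable_continuous_circlepath)
            (auto intro!: continuous_intros)
        show "norm (f z / (G z - w)) \<le> 2 * A / norm w" if "norm (z - a) = r" for z
        proof -
          have z: "z \<in> sphere a r" using that by (simp add: dist_norm norm_minus_commute)
          have "norm (f z / (G z - w)) \<le> A / (norm w / 2)"
            unfolding norm_divide using A low[OF z] z wpos by (intro frac_le) auto
          then show ?thesis by (simp add: mult.commute)
        qed
      qed (use A r in auto)
      then show "norm (contour_integral (circlepath a r) (\<lambda>z. f z / (G z - w)))
        \<le> (2 * A * (2 * pi * r)) * norm (inverse w)"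
        by (simp add: norm_inverse norm_divide field_simps)
    qed
    show "((\<lambda>w::complex. (2 * A * (2 * pi * r)) * norm (inverse w)) \<longlongrightarrow> 0) at_infinity"
      by (intro tendsto_mult_right_zero tendsto_norm_zero tendsto_inverse_0)
  qed
qed

section \<open>The residue of a form with a single pole\<close>

text \<open>The setting for the push-forward: \<open>F\<close> has its only pole at
  \<open>P\<close>, and it is at least as deep as the pole that the form may have there. The
  function \<open>ch\<close> fixes one chart per point for residues and expansions. Since
  \<open>fls_subdegree 0 = 0\<close>, the order conditions admit a vanishing expansion of the
  form.\<close>

locale single_pole_form = charted_surface \<Phi> for \<Phi> :: "('a::t2_space) chart set" +
  fixes S :: "'a set" and \<omega> :: "('a, complex) form" and F :: "'a \<Rightarrow> complex"
    and P :: 'a and ch :: "'a \<Rightarrow> 'a chart"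
  assumes compact: "compact (UNIV :: 'a set)" and connected: "connected (UNIV :: 'a set)"
    and finite_S: "finite S"
    and form: "meromorphic_form \<Phi> S \<omega>"
    and ch: "ch p \<in> charts_at \<Phi> p"
    and regular: "p \<noteq> P \<Longrightarrow> 0 \<le> fls_subdegree (laurent_at (ch p) p (\<omega> (ch p)))"
    and F_meromorphic: "c \<in> \<Phi> \<Longrightarrow> in_chart c F meromorphic_on snd c ` fst c"
    and F_analytic: "c \<in> \<Phi> \<Longrightarrow> in_chart c F analytic_on snd c ` (fst c - {P})"
    and F_pole: "fls_subdegree (laurent_at (ch P) P F) < 0"
    and F_order: "fls_subdegree (laurent_at (ch P) P F) \<le> fls_subdegree (laurent_at (ch P) P (\<omega> (ch P)))"
begin

section \<open>Quotient forms and the push-forward\<close>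

abbreviation \<zeta> :: "'a \<Rightarrow> complex" where "\<zeta> p \<equiv> snd (ch p) p"

definition quot_form :: "complex \<Rightarrow> 'a chart \<Rightarrow> 'a \<Rightarrow> complex" where
  "quot_form w c = (\<lambda>p. \<omega> c p / (F p - w))"

definition res :: "complex \<Rightarrow> 'a \<Rightarrow> complex" where
  "res w p = residue (in_chart (ch p) (quot_form w (ch p))) (\<zeta> p)"

text \<open>\<open>P\<close> is left out because \<open>F\<close> has a pole there and the value
  \<open>F P\<close> carries no information.\<close>

definition fibre :: "complex \<Rightarrow> 'a set" where
  "fibre w = {p. p \<noteq> P \<and> F p = w}"

text \<open>
  The trace of \<open>\<omega>\<close> along \<open>F\<close>: where \<open>F\<close> is unramified, \<open>push_forward w\<close> is the sum of the values
  of \<open>\<omega> / dF\<close> over the fibre of \<open>w\<close>.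
\<close>

definition push_forward :: "complex \<Rightarrow> complex" where
  "push_forward w = (\<Sum>p\<in>fibre w. res w p)"

lemma ch' [simp]: "ch p \<in> \<Phi>" "p \<in> fst (ch p)"
  using ch[of p] by (auto simp: charts_at_def)

lemma \<zeta>_in: "\<zeta> p \<in> snd (ch p) ` fst (ch p)"
  by simp

lemma form_meromorphic: "c \<in> \<Phi> \<Longrightarrow> in_chart c (\<omega> c) meromorphic_on snd c ` fst c"
  and form_analytic: "c \<in> \<Phi> \<Longrightarrow> in_chart c (\<omega> c) analytic_on snd c ` (fst c - S)"
  using form by (auto simp: meromorphic_form_def)

lemma form_transition:
  assumes "c \<in> \<Phi>" "d \<in> \<Phi>" "x \<in> fst c \<inter> fst d - S"
  shows "\<omega> c x = deriv (\<lambda>z. snd d (chart_inv c z)) (snd c x) * \<omega> d x"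
  using form assms unfolding meromorphic_form_def by blast

lemma in_chart_quot_form: "in_chart c (quot_form w c) = (\<lambda>z. in_chart c (\<omega> c) z / (in_chart c F z - w))"
  by (simp add: in_chart_def quot_form_def)

lemma quot_form_meromorphic: "c \<in> \<Phi> \<Longrightarrow> in_chart c (quot_form w c) meromorphic_on snd c ` fst c"
  unfolding in_chart_quot_form
  by (intro meromorphic_intros form_meromorphic F_meromorphic)

lemma laurent:
  shows "(\<lambda>z. in_chart (ch p) (\<omega> (ch p)) (\<zeta> p + z)) has_laurent_expansion laurent_at (ch p) p (\<omega> (ch p))"
    and "(\<lambda>z. in_chart (ch p) F (\<zeta> p + z)) has_laurent_expansion laurent_at (ch p) p F"
  using form_meromorphic[of "ch p"] F_meromorphic[of "ch p"] \<zeta>_in[of p]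
  unfolding meromorphic_on_def' laurent_at_def by simp_all

section \<open>The function \<open>F\<close>: continuity, its pole and its fibres\<close>

lemma isCont_F: "p \<noteq> P \<Longrightarrow> isCont F p"
proof -
  assume p: "p \<noteq> P"
  define c where "c = ch p"
  have c: "c \<in> \<Phi>" "p \<in> fst c" by (simp_all add: c_def)
  have "in_chart c F analytic_on {snd c p}"
    using F_analytic[OF c(1)] p c by (auto elim: analytic_on_subset)
  then have "isCont (in_chart c F) (snd c p)"
    by (rule analytic_at_imp_isCont)
  then have "isCont (\<lambda>x. in_chart c F (snd c x)) p"
    by (intro isCont_o2[OF isCont_chart[OF c]]) 
  moreover have ev: "\<forall>\<^sub>F x in nhds p. in_chart c F (snd c x) = F x"
    using eventually_nhds_in_open[OF open_chart_domain[OF c(1)] c(2)]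
    by eventually_elim (use c in \<open>simp add: in_chart_def\<close>)
  ultimately show ?thesis
    using isCont_cong[OF ev] by blast
qed

lemma F_at_P: "\<forall>\<^sub>F x in at P. norm (F x) > M"
proof -
  have "filterlim (in_chart (ch P) F) at_infinity (at (\<zeta> P))"
    using has_laurent_expansion_imp_filterlim_infinity[OF laurent(2) F_pole] .
  then have "\<forall>\<^sub>F z in at (\<zeta> P). norm (in_chart (ch P) F z) > M"
    by (simp add: filterlim_at_infinity_conv_norm_at_top filterlim_at_top_dense)
  then show ?thesis
    by (subst eventually_at_chart[of "ch P"]) (simp_all add: in_chart_def)
qed

text \<open>Identity theorem on the surface: the set \<open>E\<close> of points near which
  \<open>F\<close> equals \<open>w\<close> is open, and so is its complement, by the dichotomy for
  Laurent expansions. Connectedness leaves \<open>E\<close> empty, because \<open>F\<close> tends to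
  infinity at \<open>P\<close>.\<close>

lemma eventually_F_neq: "\<forall>\<^sub>F x in at p. F x \<noteq> w"
proof -
  define E where "E = {p. \<forall>\<^sub>F x in at p. F x = w}"
  have dich: "(\<forall>\<^sub>F x in at p. F x = w) \<or> (\<forall>\<^sub>F x in at p. F x \<noteq> w)" for p
  proof -
    have "(\<lambda>z. in_chart (ch p) F (\<zeta> p + z) - w) has_laurent_expansion
        laurent_at (ch p) p F - fls_const w"
      by (intro laurent_expansion_intros laurent)
    then have "(\<forall>\<^sub>F z in at (\<zeta> p). in_chart (ch p) F z - w \<noteq> 0) \<or> (\<forall>\<^sub>F z in at (\<zeta> p). in_chart (ch p) F z - w = 0)"
      using has_laurent_expansion_eventually_nonzero_iff[of "\<lambda>z. in_chart (ch p) F z - w"]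
        has_laurent_expansion_eventually_zero_iff[of "\<lambda>z. in_chart (ch p) F z - w"] by blast
    then show ?thesis
      by (auto simp: eventually_at_chart[of "ch p" p] in_chart_def)
  qed
  \<comment> \<open>A neighbourhood of \<open>p\<close> without \<open>p\<close> is a neighbourhood
    of each of its other points, so a property that holds near \<open>p\<close> also holds near
    those.\<close>
  have op: "open {p. \<forall>\<^sub>F x in at p. Q x}" for Q :: "'a \<Rightarrow> bool"
  proof (subst open_subopen, safe)
    fix p assume "\<forall>\<^sub>F x in at p. Q x"
    then obtain U where U: "open U" "p \<in> U" "\<And>x. x \<in> U \<Longrightarrow> x \<noteq> p \<Longrightarrow> Q x"
      by (auto simp: eventually_at_topological)
    have "\<forall>\<^sub>F x in at y. Q x" if "y \<in> U" for y
    proof (cases "y = p")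
      case False
      then have "\<forall>\<^sub>F x in at y. x \<in> U - {p}"
        using U that by (intro eventually_at_in_open') auto
      then show ?thesis using U by (auto elim!: eventually_mono)
    qed (use U eventually_at_topological in blast)
    then show "\<exists>T. open T \<and> p \<in> T \<and> T \<subseteq> {p. \<forall>\<^sub>F x in at p. Q x}"
      using U by blast
  qed
  have compl: "- E = {p. \<forall>\<^sub>F x in at p. F x \<noteq> w}"
  proof (rule Set.set_eqI, rule iffI)
    fix p
    show "p \<in> - E \<Longrightarrow> p \<in> {p. \<forall>\<^sub>F x in at p. F x \<noteq> w}"
      using dich[of p] by (auto simp: E_def)
    assume "p \<in> {p. \<forall>\<^sub>F x in at p. F x \<noteq> w}"
    then have 1: "\<forall>\<^sub>F x in at p. F x \<noteq> w" by simp
    have "\<not> (\<forall>\<^sub>F x in at p. F x = w)"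
    proof
      assume "\<forall>\<^sub>F x in at p. F x = w"
      with 1 have "\<forall>\<^sub>F x in at p. False" by eventually_elim auto
      then show False using at_surface_neq_bot by (simp add: eventually_False)
    qed
    then show "p \<in> - E" by (simp add: E_def)
  qed
  have "open E" "open (- E)"
    unfolding compl using op by (simp_all add: E_def)
  then have "E = {} \<or> E = UNIV"
    using connectedD[OF connected, of E "- E"] by auto
  moreover have "P \<notin> E"
  proof -
    have "\<forall>\<^sub>F x in at P. F x \<noteq> w"
      using F_at_P[of "norm w"] by eventually_elim auto
    then show ?thesis using compl by blast
  qed
  ultimately have "p \<in> - E" by auto
  then show ?thesis by (simp add: compl)
qed

text \<open>An infinite fibre would accumulate somewhere on the compact surface, against
  \<open>eventually_F_neq\<close>.\<close>

lemma finite_fibre: "finite (fibre w)"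
proof -
  have "finite (UNIV \<inter> {p. F p = w})"
    using eventually_F_neq
    by (intro finite_not_islimpt_in_compact compact) (simp add: islimpt_iff_eventually)
  then show ?thesis by (rule finite_subset[rotated]) (auto simp: fibre_def)
qed

section \<open>Residues of the quotient forms and the residue theorem in a chart\<close>

lemma res_eq_0:
  assumes "p = P \<or> F p \<noteq> w"
  shows "res w p = 0"
proof -
  define A where "A = laurent_at (ch p) p (\<omega> (ch p))"
  \<comment> \<open>Orders add up under multiplication, so the second condition puts the exponent -1
    below the order of \<open>A * D\<close>.\<close>
  obtain D where D: "(\<lambda>z. inverse (in_chart (ch p) F (\<zeta> p + z) - w)) has_laurent_expansion D"
    and AD: "-1 < fls_subdegree A + fls_subdegree D"
  proof (cases "p = P")
    case True
    define B where "B = laurent_at (ch p) p F - fls_const w"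
    have B: "(\<lambda>z. in_chart (ch p) F (\<zeta> p + z) - w) has_laurent_expansion B"
      unfolding B_def by (intro laurent_expansion_intros laurent)
    \<comment> \<open>Subtracting a constant does not change the order of a pole.\<close>
    have "fls_subdegree B = fls_subdegree (laurent_at (ch p) p F)"
      unfolding B_def using F_pole True
      by (intro fls_subdegree_diff_eq1) auto
    \<comment> \<open>The pole of \<open>F\<close> at \<open>P\<close> is at least as deep as that
      of the form, so the quotient has no pole at \<open>P\<close>, whatever \<open>w\<close>
      is.\<close>
    with F_order F_pole True have "fls_subdegree B \<le> fls_subdegree A" "B \<noteq> 0"
      by (auto simp: A_def)
    then show ?thesis
      using that[OF has_laurent_expansion_inverse[OF B]] by (simp add: fls_inverse_subdegree)
  next
    case False
    then have "F p \<noteq> w" using assms by simp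
    have "in_chart (ch p) F analytic_on {\<zeta> p}"
      using F_analytic[of "ch p"] False by (auto elim!: analytic_on_subset)
    then have "(\<lambda>z. inverse (in_chart (ch p) F z - w)) analytic_on {\<zeta> p}"
      using \<open>F p \<noteq> w\<close> by (auto intro!: analytic_intros simp: in_chart_def)
    then obtain G where "(\<lambda>z. inverse (in_chart (ch p) F (\<zeta> p + z) - w)) has_fps_expansion G"
      using analytic_at_imp_has_fps_expansion by blast
    then show ?thesis
      using that[OF has_laurent_expansion_fps] regular[OF False]
      by (simp add: A_def fls_subdegree_fls_to_fps)
  qed
  have "(\<lambda>z. in_chart (ch p) (quot_form w (ch p)) (\<zeta> p + z)) has_laurent_expansion A * D"
    unfolding in_chart_quot_form A_def divide_inverse by (intro laurent_expansion_intros laurent D)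
  then have "res w p = fls_residue (A * D)"
    unfolding res_def by (rule has_laurent_expansion_residue)
  also have "\<dots> = 0"
    using fls_times_nth_eq0[OF AD] by simp
  finally show ?thesis .
qed

text \<open>The residue theorem on the disc of radius \<open>2 * r\<close>. The centre
  \<open>q\<close> may be \<open>P\<close>, a point of \<open>S\<close> or a point of the fibre, so
  it always counts as a possible singularity; when it is not in the fibre, \<open>res_eq_0\<close>
  makes its contribution 0.\<close>

lemma contour_integral_quot_form:
  assumes r: "r > 0" "ball (\<zeta> q) (2 * r) \<subseteq> snd (ch q) ` fst (ch q)"
    and disc: "\<And>z. z \<in> ball (\<zeta> q) (2 * r) \<Longrightarrow> z \<noteq> \<zeta> q \<Longrightarrow> chart_inv (ch q) z \<notin> S \<and> chart_inv (ch q) z \<noteq> P"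
    and circ: "\<And>z. z \<in> sphere (\<zeta> q) r \<Longrightarrow> F (chart_inv (ch q) z) \<noteq> w"
  shows "contour_integral (circlepath (\<zeta> q) r) (in_chart (ch q) (quot_form w (ch q)))
     = 2 * pi * \<i> * (\<Sum>p\<in>fibre w \<inter> chart_inv (ch q) ` ball (\<zeta> q) r. res w p)"
proof -
  define c where "c = ch q"
  define a where "a = \<zeta> q"
  define f where "f = in_chart c (quot_form w c)"
  have c: "c \<in> \<Phi>" "q \<in> fst c" and a: "a = snd c q" by (simp_all add: c_def a_def)
  note r = r[folded c_def a_def] and disc = disc[folded c_def a_def] and circ = circ[folded c_def a_def]
  have ball_sub: "ball a r \<subseteq> ball a (2 * r)" "sphere a r \<subseteq> ball a (2 * r)" using r(1) by auto
  define Z where "Z = {z \<in> ball a (2 * r). chart_inv c z \<in> fibre w}"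
  \<comment> \<open>All possible singularities in the large disc. Those outside the circle have
    winding number 0 and drop out.\<close>
  define pts where "pts = insert a Z"
  have injB: "inj_on (chart_inv c) (ball a (2 * r))"
    using inj_on_chart_inv[OF c(1)] r(2) by (rule inj_on_subset)
  have finZ: "finite Z"
  proof (rule finite_imageD)
    show "finite (chart_inv c ` Z)"
      by (rule finite_subset[OF _ finite_fibre[of w]]) (auto simp: Z_def)
    show "inj_on (chart_inv c) Z"
      by (rule inj_on_subset[OF injB]) (auto simp: Z_def)
  qed
  have inv_in: "chart_inv c z \<in> fst c" if "z \<in> ball a (2 * r)" for z
    using r(2) that c by (intro chart_inv_in) auto
  have an: "f analytic_on {z}" if "z \<in> ball a (2 * r) - pts" for z
  proof -
    have z: "z \<in> snd c ` fst c" "z \<noteq> a" "chart_inv c z \<notin> S" "chart_inv c z \<noteq> P" "F (chart_inv c z) \<noteq> w"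
      using that r(2) disc[of z] by (auto simp: pts_def Z_def fibre_def)
    have "z \<in> snd c ` (fst c - S)" "z \<in> snd c ` (fst c - {P})"
      using z c(1) by (intro image_eqI[of _ _ "chart_inv c z"]; simp)+
    then have "in_chart c (\<omega> c) analytic_on {z}" "in_chart c F analytic_on {z}"
      using form_analytic[OF c(1)] F_analytic[OF c(1)] by (auto elim!: analytic_on_subset)
    then show ?thesis
      unfolding f_def in_chart_quot_form using z by (auto intro!: analytic_intros simp: in_chart_def)
  qed
  have "contour_integral (circlepath a r) f =
      2 * pi * \<i> * (\<Sum>p\<in>pts. winding_number (circlepath a r) p * residue f p)"
  proof (rule Residue_theorem[of "ball a (2 * r)"])
    show "f holomorphic_on ball a (2 * r) - pts"
      using an by (intro analytic_imp_holomorphic) (subst analytic_on_analytic_at, blast)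
    show "path_image (circlepath a r) \<subseteq> ball a (2 * r) - pts"
    proof -
      have "z \<notin> pts" if "z \<in> sphere a r" for z
        using that circ[OF that] r(1) by (auto simp: pts_def Z_def fibre_def)
      then show ?thesis using r(1) ball_sub by auto
    qed
    show "\<forall>z. z \<notin> ball a (2 * r) \<longrightarrow> winding_number (circlepath a r) z = 0"
      using r(1) ball_sub by (auto intro!: winding_number_zero_outside[of _ "ball a (2*r)"])
  qed (use finZ in \<open>auto simp: pts_def\<close>)
  also have "(\<Sum>p\<in>pts. winding_number (circlepath a r) p * residue f p) = (\<Sum>z\<in>insert a (Z \<inter> ball a r). residue f z)"
  proof (rule sum.mono_neutral_cong_right)
    show "\<forall>z\<in>pts - insert a (Z \<inter> ball a r). winding_number (circlepath a r) z * residue f z = 0"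
    proof
      fix z assume z: "z \<in> pts - insert a (Z \<inter> ball a r)"
      then have "z \<notin> sphere a r" using circ by (auto simp: pts_def Z_def fibre_def)
      then have "z \<notin> cball a r" using z by (auto simp: pts_def)
      then have "winding_number (circlepath a r) z = 0"
        using r(1) by (intro winding_number_zero_outside[of _ "cball a r"]) auto
      then show "winding_number (circlepath a r) z * residue f z = 0" by simp
    qed
    show "winding_number (circlepath a r) z * residue f z = residue f z" if "z \<in> insert a (Z \<inter> ball a r)" for z
      using that r(1) winding_number_circlepath[of z a r] by (auto simp: dist_norm norm_minus_commute)
  qed (use finZ in \<open>auto simp: pts_def\<close>)
  also have "\<dots> = (\<Sum>z\<in>insert a (Z \<inter> ball a r). res w (chart_inv c z))"
  proof (rule sum.cong[OF refl])
    fix z assume z: "z \<in> insert a (Z \<inter> ball a r)"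
    show "residue f z = res w (chart_inv c z)"
    proof (cases "z = a")
      case True
      then show ?thesis by (simp add: f_def res_def c_def a_def)
    next
      case False
      define p where "p = chart_inv c z"
      define d where "d = ch p"
      have zB: "z \<in> ball a (2 * r)" using z False ball_sub by auto
      have p: "p \<in> fst c" "p \<notin> S" "snd c p = z"
        using inv_in[OF zB] disc[OF zB False] r(2) zB c(1) by (auto simp: p_def)
      have d: "d \<in> \<Phi>" "p \<in> fst d" by (simp_all add: d_def)
      \<comment> \<open>Away from the centre the point is outside \<open>S\<close>, so the
        transformation rule holds around it and its residue may be computed in its own
        chart.\<close>
      have "residue (in_chart c (quot_form w c)) (snd c p) = residue (in_chart d (quot_form w d)) (snd d p)"
      proof (rule residue_chart_independent[OF c(1) p(1) d])
        have "\<forall>\<^sub>F x in at p. x \<in> fst c \<inter> fst d - S"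
          using p d c(1) finite_S
          by (intro eventually_at_in_open' open_Diff open_Int open_chart_domain finite_imp_closed) auto
        then show "\<forall>\<^sub>F x in at p. quot_form w c x = deriv (\<lambda>z. snd d (chart_inv c z)) (snd c x) * quot_form w d x"
          by eventually_elim (use form_transition[OF c(1) d(1)] in \<open>simp add: quot_form_def\<close>)
        show "in_chart d (quot_form w d) meromorphic_on {snd d p}"
          using d(2) by (intro meromorphic_on_subset[OF quot_form_meromorphic[OF d(1)]]) simp
      qed
      then show ?thesis by (simp add: f_def res_def p_def[symmetric] d_def[symmetric] p)
    qed
  qed
  also have "\<dots> = (\<Sum>p\<in>chart_inv c ` insert a (Z \<inter> ball a r). res w p)"
  proof -
    have "insert a (Z \<inter> ball a r) \<subseteq> ball a (2 * r)" using ball_sub r(1) by auto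
    then show ?thesis by (simp only: sum.reindex[OF inj_on_subset[OF injB]] o_def)
  qed
  also have "\<dots> = (\<Sum>p\<in>fibre w \<inter> chart_inv c ` ball a r. res w p)"
  proof (rule sum.mono_neutral_right)
    show "fibre w \<inter> chart_inv c ` ball a r \<subseteq> chart_inv c ` insert a (Z \<inter> ball a r)"
      using ball_sub by (auto simp: Z_def)
    show "\<forall>p\<in>chart_inv c ` insert a (Z \<inter> ball a r) - fibre w \<inter> chart_inv c ` ball a r. res w p = 0"
    proof
      fix p assume p: "p \<in> chart_inv c ` insert a (Z \<inter> ball a r) - fibre w \<inter> chart_inv c ` ball a r"
      then have "p \<notin> fibre w" using r(1) by (auto simp: Z_def)
      then show "res w p = 0" by (intro res_eq_0) (auto simp: fibre_def)
    qed
  qed (use finZ in auto)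
  finally show ?thesis by (simp add: f_def c_def a_def)
qed

section \<open>The push-forward as a sum of circle integrals\<close>

lemma push_forward_eq_far:
  obtains r M where "r > 0" "ball (\<zeta> P) (2 * r) \<subseteq> snd (ch P) ` fst (ch P)"
    "\<And>z. z \<in> ball (\<zeta> P) (2 * r) \<Longrightarrow> z \<noteq> \<zeta> P \<Longrightarrow> chart_inv (ch P) z \<notin> S \<and> chart_inv (ch P) z \<noteq> P"
    "\<And>w z. norm w > M \<Longrightarrow> z \<in> sphere (\<zeta> P) r \<Longrightarrow> F (chart_inv (ch P) z) \<noteq> w"
    "\<And>w. norm w > M \<Longrightarrow>
       contour_integral (circlepath (\<zeta> P) r) (in_chart (ch P) (quot_form w (ch P))) = 2 * pi * \<i> * push_forward w"
proof -
  define c where "c = ch P"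
  define a where "a = \<zeta> P"
  have c: "c \<in> \<Phi>" "P \<in> fst c" and a: "a = snd c P" by (simp_all add: c_def a_def)
  have "\<forall>\<^sub>F x in at P. x \<in> - (S - {P})"
    using finite_S by (intro eventually_at_in_open' open_Compl finite_imp_closed) auto
  then have ev: "\<forall>\<^sub>F x in at P. x \<notin> S \<and> x \<noteq> P"
    using eventually_neq_at_within[of P P UNIV] by eventually_elim auto
  obtain r where r: "r > 0" "ball a (2 * r) \<subseteq> snd c ` fst c"
    "\<And>z. z \<in> ball a (2 * r) \<Longrightarrow> z \<noteq> a \<Longrightarrow> chart_inv c z \<notin> S \<and> chart_inv c z \<noteq> P"
    unfolding a using chart_disc[OF c ev] by blast
  have sub: "ball a r \<subseteq> ball a (2 * r)" "sphere a r \<subseteq> ball a (2 * r)" using r(1) by auto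
  define U where "U = chart_inv c ` ball a r"
  have "open U" unfolding U_def using r sub by (intro open_chart_inv_image[OF c(1)]) auto
  have "P \<in> U" unfolding U_def using r c by (intro image_eqI[of _ _ a]) (auto simp: a)
  have "compact (- U)"
    using compact_diff[OF compact \<open>open U\<close>] by (simp add: Compl_eq_Diff_UNIV)
  moreover have "continuous_on (- U) F"
    using \<open>P \<in> U\<close> by (intro continuous_at_imp_continuous_on ballI isCont_F) auto
  \<comment> \<open>By compactness \<open>F\<close> is bounded outside the disc \<open>U\<close>
    around \<open>P\<close>. For \<open>norm w\<close> above the bound, the whole fibre of
    \<open>w\<close> lies in \<open>U\<close>, and one circle around \<open>P\<close> collects all
    its residues.\<close>
  ultimately have "bounded (F ` (- U))" by (intro compact_imp_bounded compact_continuous_image)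
  then obtain M where M: "\<And>p. p \<notin> U \<Longrightarrow> norm (F p) \<le> M"
    unfolding bounded_iff by blast
  have circ: "F (chart_inv c z) \<noteq> w" if "norm w > M" "z \<in> sphere a r" for w z
  proof -
    have "chart_inv c z \<notin> U"
    proof
      assume "chart_inv c z \<in> U"
      then obtain z' where z': "z' \<in> ball a r" "chart_inv c z = chart_inv c z'" by (auto simp: U_def)
      then have "z = z'"
        using inj_onD[OF inj_on_subset[OF inj_on_chart_inv[OF c(1)] r(2)], of z z'] sub that(2) by blast
      then show False using z' that(2) by auto
    qed
    then show ?thesis using M[of "chart_inv c z"] that(1) by auto
  qed
  show ?thesis
  proof (rule that[of r M, folded c_def a_def])
    fix w :: complex assume w: "norm w > M"
    have "p \<in> U" if "p \<in> fibre w" for p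
      using M[of p] w that by (cases "p \<in> U") (auto simp: fibre_def)
    then have "fibre w \<inter> U = fibre w" by blast
    then show "contour_integral (circlepath a r) (in_chart c (quot_form w c)) = 2 * pi * \<i> * push_forward w"
      using contour_integral_quot_form[of r P w, folded c_def a_def] r circ[OF w]
      by (simp add: U_def push_forward_def)
  qed (use r circ in auto)
qed

text \<open>Small circles around the points of \<open>fibre w0\<close> serve all \<open>w\<close>
  near \<open>w0\<close>: away from their discs and from \<open>P\<close>, the function keeps a
  positive distance from \<open>w0\<close> by compactness, and near \<open>P\<close> it is too
  large. So the push-forward is locally a finite sum of integrals that are holomorphic in
  \<open>w\<close>.\<close>

lemma push_forward_holomorphic: "push_forward holomorphic_on UNIV"
proof -
  have "\<exists>e>0. push_forward holomorphic_on ball w0 e" for w0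
  proof -
    obtain V where V: "\<And>q. q \<in> fibre w0 \<Longrightarrow> open (V q)" "\<And>q. q \<in> fibre w0 \<Longrightarrow> q \<in> V q"
      "disjoint_family_on V (fibre w0)"
      using finite_disjoint_open_nhds[OF finite_fibre] by metis
    have "\<exists>r>0. ball (\<zeta> q) (2 * r) \<subseteq> snd (ch q) ` fst (ch q) \<and> (\<forall>z\<in>ball (\<zeta> q) (2 * r) - {\<zeta> q}.
        chart_inv (ch q) z \<in> V q - S - {P} \<and> F (chart_inv (ch q) z) \<noteq> w0)"
      if q: "q \<in> fibre w0" for q
    proof -
      have "\<forall>\<^sub>F x in at q. x \<in> V q - (S - {q}) - {P}"
        using V q finite_S
        by (intro eventually_at_in_open') (auto intro!: open_Diff finite_imp_closed simp: fibre_def)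
      then have ev: "\<forall>\<^sub>F x in at q. x \<in> V q - S - {P} \<and> F x \<noteq> w0"
        using eventually_F_neq[of w0 q] eventually_neq_at_within[of q q UNIV]
        by eventually_elim auto
      show ?thesis using chart_disc[OF ch' ev] by simp
    qed
    then obtain r where r_all: "\<And>q. q \<in> fibre w0 \<Longrightarrow> r q > 0 \<and> ball (\<zeta> q) (2 * r q) \<subseteq> snd (ch q) ` fst (ch q) \<and>
        (\<forall>z\<in>ball (\<zeta> q) (2 * r q) - {\<zeta> q}.
        chart_inv (ch q) z \<in> V q - S - {P} \<and> F (chart_inv (ch q) z) \<noteq> w0)"
      by metis
    have r: "\<And>q. q \<in> fibre w0 \<Longrightarrow> r q > 0"
      "\<And>q. q \<in> fibre w0 \<Longrightarrow> ball (\<zeta> q) (2 * r q) \<subseteq> snd (ch q) ` fst (ch q)"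
      "\<And>q z. q \<in> fibre w0 \<Longrightarrow> z \<in> ball (\<zeta> q) (2 * r q) \<Longrightarrow> z \<noteq> \<zeta> q \<Longrightarrow>
         chart_inv (ch q) z \<in> V q - S - {P} \<and> F (chart_inv (ch q) z) \<noteq> w0"
      using r_all by auto
    have sub: "ball (\<zeta> q) (r q) \<subseteq> ball (\<zeta> q) (2 * r q)" "sphere (\<zeta> q) (r q) \<subseteq> ball (\<zeta> q) (2 * r q)"
      if "q \<in> fibre w0" for q
      using r(1)[OF that] by auto
    define B where "B q = chart_inv (ch q) ` ball (\<zeta> q) (r q)" for q
    define C where "C q = chart_inv (ch q) ` sphere (\<zeta> q) (r q)" for q
    have openB: "open (B q)" and qB: "q \<in> B q" and BV: "B q \<subseteq> V q" if q: "q \<in> fibre w0" for q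
    proof -
      show "open (B q)"
        unfolding B_def using r[OF q] sub[OF q] by (intro open_chart_inv_image) auto
      show "q \<in> B q"
        unfolding B_def using r(1)[OF q] by (intro image_eqI[of _ _ "\<zeta> q"]) auto
      show "B q \<subseteq> V q"
      proof
        fix x assume "x \<in> B q"
        then obtain z where z: "z \<in> ball (\<zeta> q) (r q)" "x = chart_inv (ch q) z" by (auto simp: B_def)
        then show "x \<in> V q" using r(3)[OF q, of z] sub(1)[OF q] V(2)[OF q] by (cases "z = \<zeta> q") auto
      qed
    qed
    have circ: "x \<noteq> P \<and> F x \<noteq> w0" if q: "q \<in> fibre w0" and x: "x \<in> C q" for q x
    proof -
      obtain z where z: "z \<in> sphere (\<zeta> q) (r q)" "x = chart_inv (ch q) z"
        using x unfolding C_def by blast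
      then have "z \<noteq> \<zeta> q" using r(1)[OF q] by auto
      then show ?thesis using r(3)[OF q, of z] sub(2)[OF q] z by auto
    qed
    obtain U where U: "open U" "P \<in> U" "\<And>x. x \<in> U \<Longrightarrow> x \<noteq> P \<Longrightarrow> norm (F x) > norm w0 + 1"
      using F_at_P[of "norm w0 + 1"] by (auto simp: eventually_at_topological)
    \<comment> \<open>The circles are put into \<open>K\<close> together with the complement of
      \<open>U\<close> and the discs. If \<open>w\<close> is not a value of \<open>F\<close> on
      \<open>K\<close>, then the fibre of \<open>w\<close> lies in \<open>U\<close> or the discs,
      and no circle meets it.\<close>
    define K where "K = - (U \<union> (\<Union>q\<in>fibre w0. B q)) \<union> (\<Union>q\<in>fibre w0. C q)"
    have "compact (C q)" if q: "q \<in> fibre w0" for q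
      unfolding C_def
    proof (rule compact_continuous_image)
      have "sphere (\<zeta> q) (r q) \<subseteq> snd (ch q) ` fst (ch q)"
        using sub(2)[OF q] r(2)[OF q] by blast
      then show "continuous_on (sphere (\<zeta> q) (r q)) (chart_inv (ch q))"
        using homeomorphism_chart[of "ch q"] continuous_on_subset by (force simp: homeomorphism_def)
    qed simp
    moreover have "compact (- (U \<union> (\<Union>q\<in>fibre w0. B q)))"
    proof -
      have "open (U \<union> (\<Union>q\<in>fibre w0. B q))" using U openB by auto
      from compact_diff[OF compact this] show ?thesis by (simp only: Compl_eq_Diff_UNIV)
    qed
    ultimately have "compact K"
      unfolding K_def by (intro compact_Un compact_UN finite_fibre) auto
    moreover have "P \<notin> K" using U circ by (auto simp: K_def)
    then have "continuous_on K F"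
      by (intro continuous_at_imp_continuous_on ballI isCont_F) auto
    ultimately have "closed (F ` K)"
      by (intro compact_imp_closed compact_continuous_image)
    moreover have "w0 \<notin> F ` K"
    proof
      assume "w0 \<in> F ` K"
      then obtain x where x: "x \<in> K" "F x = w0" by auto
      then have "x \<in> fibre w0" using \<open>P \<notin> K\<close> by (auto simp: fibre_def)
      then show False using x qB circ by (auto simp: K_def)
    qed
    ultimately obtain e0 where e0: "e0 > 0" "ball w0 e0 \<subseteq> - (F ` K)"
      unfolding closed_def open_contains_ball by blast
    \<comment> \<open>The radius \<open>e0\<close> keeps \<open>w\<close> off the image of
      \<open>K\<close>, and 1 is the margin left in the choice of \<open>U\<close>, so that no fibre
      point lies in \<open>U\<close>.\<close>
    define e where "e = min e0 1"
    have e: "e > 0" using e0 by (simp add: e_def)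
    have FK: "F x \<noteq> w" if "x \<in> K" "w \<in> ball w0 e" for x w
      using that e0 by (auto simp: e_def)
    have CK: "chart_inv (ch q) z \<in> K" if "q \<in> fibre w0" "z \<in> sphere (\<zeta> q) (r q)" for q z
      using that unfolding K_def C_def by blast
    define I where "I q w = contour_integral (circlepath (\<zeta> q) (r q)) (in_chart (ch q) (quot_form w (ch q)))" for q w
    have eq: "push_forward w = (\<Sum>q\<in>fibre w0. I q w / (2 * pi * \<i>))" if w: "w \<in> ball w0 e" for w
    proof -
      have "fibre w \<subseteq> (\<Union>q\<in>fibre w0. B q)"
      proof
        fix p assume p: "p \<in> fibre w"
        then have "p \<notin> K" using FK w by (auto simp: fibre_def)
        moreover have "p \<notin> U"
        proof
          assume "p \<in> U"
          then have "norm w > norm w0 + 1" using U(3)[of p] p by (auto simp: fibre_def)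
          moreover have "norm w \<le> norm w0 + norm (w - w0)" by (rule norm_triangle_sub)
          ultimately show False using w by (simp add: e_def dist_norm norm_minus_commute)
        qed
        ultimately show "p \<in> (\<Union>q\<in>fibre w0. B q)" by (auto simp: K_def)
      qed
      then have "fibre w = (\<Union>q\<in>fibre w0. fibre w \<inter> B q)" by auto
      then have "push_forward w = (\<Sum>p\<in>(\<Union>q\<in>fibre w0. fibre w \<inter> B q). res w p)"
        by (simp add: push_forward_def)
      \<comment> \<open>Each \<open>B q\<close> lies in \<open>V q\<close>, and these are disjoint,
        so no residue is counted twice.\<close>
      also have "\<dots> = (\<Sum>q\<in>fibre w0. \<Sum>p\<in>fibre w \<inter> B q. res w p)"
      proof (rule sum.UNION_disjoint)
        show "\<forall>q\<in>fibre w0. \<forall>q'\<in>fibre w0. q \<noteq> q' \<longrightarrow> fibre w \<inter> B q \<inter> (fibre w \<inter> B q') = {}"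
          using BV V(3) by (fastforce simp: disjoint_family_on_def)
      qed (use finite_fibre in auto)
      also have "\<dots> = (\<Sum>q\<in>fibre w0. I q w / (2 * pi * \<i>))"
      proof (rule sum.cong[OF refl])
        fix q assume q: "q \<in> fibre w0"
        have "I q w = 2 * pi * \<i> * (\<Sum>p\<in>fibre w \<inter> B q. res w p)"
          unfolding I_def B_def
        proof (rule contour_integral_quot_form)
          show "F (chart_inv (ch q) z) \<noteq> w" if "z \<in> sphere (\<zeta> q) (r q)" for z
            using FK[OF CK[OF q that] w] .
        qed (use r[OF q] in auto)
        then show "(\<Sum>p\<in>fibre w \<inter> B q. res w p) = I q w / (2 * pi * \<i>)" by simp
      qed
      finally show ?thesis .
    qed
    have "(\<lambda>w. I q w) holomorphic_on ball w0 e" if q: "q \<in> fibre w0" for q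
      unfolding I_def in_chart_quot_form
    proof (rule contour_integral_quotient_holomorphic)
      have an: "z \<in> snd (ch q) ` (fst (ch q) - S)" "z \<in> snd (ch q) ` (fst (ch q) - {P})"
        if "z \<in> sphere (\<zeta> q) (r q)" for z
      proof -
        have z: "z \<in> snd (ch q) ` fst (ch q)" "z \<noteq> \<zeta> q" "z \<in> ball (\<zeta> q) (2 * r q)"
          using that sub(2)[OF q] r(1)[OF q] r(2)[OF q] by auto
        show "z \<in> snd (ch q) ` (fst (ch q) - S)" "z \<in> snd (ch q) ` (fst (ch q) - {P})"
          using r(3)[OF q z(3,2)] z(1) by (intro image_eqI[of _ _ "chart_inv (ch q) z"]; auto)+
      qed
      show "continuous_on (sphere (\<zeta> q) (r q)) (in_chart (ch q) (\<omega> (ch q)))"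
        "continuous_on (sphere (\<zeta> q) (r q)) (in_chart (ch q) F)"
        using an
        by (blast intro: holomorphic_on_imp_continuous_on analytic_imp_holomorphic
            analytic_on_subset[OF form_analytic[OF ch'(1)]] analytic_on_subset[OF F_analytic[OF ch'(1)]])+
      show "in_chart (ch q) F z \<noteq> w" if "w \<in> ball w0 e" "z \<in> sphere (\<zeta> q) (r q)" for w z
        using FK[OF CK[OF q that(2)] that(1)] by (simp add: in_chart_def)
    qed (use r(1)[OF q] in auto)
    then have "(\<lambda>w. \<Sum>q\<in>fibre w0. I q w / (2 * pi * \<i>)) holomorphic_on ball w0 e"
      by (intro holomorphic_intros) auto
    then have "push_forward holomorphic_on ball w0 e"
      by (rule holomorphic_transform) (simp add: eq)
    with e show ?thesis by blast
  qed
  then have "push_forward analytic_on UNIV"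
    by (auto simp: analytic_on_def)
  then show ?thesis by (rule analytic_imp_holomorphic)
qed

section \<open>Liouville's theorem and the vanishing of the residue\<close>

theorem residue_single_pole: "residue (in_chart (ch P) (\<omega> (ch P))) (\<zeta> P) = 0"
proof -
  define a where "a = \<zeta> P"
  define h where "h = in_chart (ch P) (\<omega> (ch P))"
  define G where "G = in_chart (ch P) F"
  obtain r M where r: "r > 0" "ball (\<zeta> P) (2 * r) \<subseteq> snd (ch P) ` fst (ch P)"
    "\<And>z. z \<in> ball (\<zeta> P) (2 * r) \<Longrightarrow> z \<noteq> \<zeta> P \<Longrightarrow> chart_inv (ch P) z \<notin> S \<and> chart_inv (ch P) z \<noteq> P"
    and GM: "\<And>w z. norm w > M \<Longrightarrow> z \<in> sphere (\<zeta> P) r \<Longrightarrow> F (chart_inv (ch P) z) \<noteq> w"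
    and far: "\<And>w. norm w > M \<Longrightarrow>
       contour_integral (circlepath (\<zeta> P) r) (in_chart (ch P) (quot_form w (ch P))) = 2 * pi * \<i> * push_forward w"
    by (rule push_forward_eq_far) (rule that; assumption)
  note r = r[folded a_def]
  have GM: "G z \<noteq> w" if "norm w > M" "z \<in> sphere a r" for w z
    using GM that by (simp add: G_def a_def in_chart_def)
  have far: "contour_integral (circlepath a r) (\<lambda>z. h z / (G z - w)) = 2 * pi * \<i> * push_forward w" if "norm w > M" for w
    using far[OF that] by (simp only: in_chart_quot_form h_def G_def a_def)
  have sph: "sphere a r \<subseteq> ball a (2 * r) - {a}" using r(1) by auto
  have dom: "z \<in> snd (ch P) ` (fst (ch P) - S)" "z \<in> snd (ch P) ` (fst (ch P) - {P})"
    if "z \<in> ball a (2 * r) - {a}" for z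
  proof -
    have "z \<in> snd (ch P) ` fst (ch P)" using that r(2) by auto
    then show "z \<in> snd (ch P) ` (fst (ch P) - S)" "z \<in> snd (ch P) ` (fst (ch P) - {P})"
      using r(3)[of z] that by (intro image_eqI[of _ _ "chart_inv (ch P) z"]; auto)+
  qed
  have hol: "h holomorphic_on ball a (2 * r) - {a}" "G holomorphic_on ball a (2 * r) - {a}"
    unfolding h_def G_def using dom
    by (blast intro: analytic_imp_holomorphic analytic_on_subset[OF form_analytic[OF ch'(1)]]
        analytic_on_subset[OF F_analytic[OF ch'(1)]])+
  then have cont: "continuous_on (sphere a r) h" "continuous_on (sphere a r) G"
    using sph by (meson holomorphic_on_imp_continuous_on holomorphic_on_subset)+
  have ev: "\<forall>\<^sub>F w in at_infinity. norm w > M" 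
    unfolding eventually_at_infinity by (intro exI[of _ "M + 1"]) auto
  have "((\<lambda>w. contour_integral (circlepath a r) (\<lambda>z. h z / (G z - w)) / (2 * pi * \<i>)) \<longlongrightarrow> 0 / (2 * pi * \<i>)) at_infinity"
    by (intro tendsto_divide contour_integral_quotient_tendsto_0 r cont) auto
  then have "((\<lambda>w. contour_integral (circlepath a r) (\<lambda>z. h z / (G z - w)) / (2 * pi * \<i>)) \<longlongrightarrow> 0) at_infinity"
    by simp
  then have "(push_forward \<longlongrightarrow> 0) at_infinity"
    by (rule Lim_transform_eventually) (use ev in \<open>eventually_elim, simp add: far\<close>)
  then have pf0: "push_forward w = 0" for w
    using Liouville_weak[OF push_forward_holomorphic] by blast
  have "((\<lambda>w. contour_integral (circlepath a r) (\<lambda>z. (h z * G z) / (G z - w))) \<longlongrightarrow> 0) at_infinity"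
    by (intro contour_integral_quotient_tendsto_0 r cont continuous_intros)
  \<comment> \<open>On the circle \<open>h * G / (G - w) = h + w * (h / (G - w))\<close>, and the
    integral of the second summand is a multiple of \<open>push_forward w\<close>, which is
    0.\<close>
  moreover have "contour_integral (circlepath a r) (\<lambda>z. (h z * G z) / (G z - w)) = contour_integral (circlepath a r) h"
    if w: "norm w > M" for w
  proof -
    have int: "h contour_integrable_on circlepath a r"
      "(\<lambda>z. w * (h z / (G z - w))) contour_integrable_on circlepath a r"
      using cont GM[OF w] r(1) by (auto intro!: contour_integrable_continuous_circlepath continuous_intros)
    have "contour_integral (circlepath a r) (\<lambda>z. (h z * G z) / (G z - w)) =
        contour_integral (circlepath a r) (\<lambda>z. h z + w * (h z / (G z - w)))"
      using GM[OF w] r(1) by (intro contour_integral_cong) (auto simp: field_simps)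
    also have "\<dots> = contour_integral (circlepath a r) h + contour_integral (circlepath a r) (\<lambda>z. w * (h z / (G z - w)))"
      using int by (rule contour_integral_add)
    also have "contour_integral (circlepath a r) (\<lambda>z. w * (h z / (G z - w))) = w * contour_integral (circlepath a r) (\<lambda>z. h z / (G z - w))"
      using cont GM[OF w] r(1) by (intro contour_integral_lmul contour_integrable_continuous_circlepath continuous_intros) auto
    finally show ?thesis using far[OF w] pf0 by simp
  qed
  then have "\<forall>\<^sub>F w in at_infinity. contour_integral (circlepath a r) (\<lambda>z. (h z * G z) / (G z - w))
      = contour_integral (circlepath a r) h"
    using ev by (rule eventually_mono[rotated])
  ultimately have "((\<lambda>w::complex. contour_integral (circlepath a r) h) \<longlongrightarrow> 0) at_infinity"
    by (rule Lim_transform_eventually)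
  then have "contour_integral (circlepath a r) h = 0"
    using tendsto_unique[OF trivial_limit_at_infinity tendsto_const] by blast
  moreover have "(h has_contour_integral 2 * pi * \<i> * residue h a) (circlepath a r)"
    using r(1) hol(1) by (intro base_residue[of "ball a (2 * r)"]) auto
  ultimately show ?thesis
    using contour_integral_unique by (fastforce simp: h_def a_def)
qed

end

section \<open>Matrices of Laurent series\<close>

definition fls_mat_nth :: "complex fls^'n^'n \<Rightarrow> int \<Rightarrow> complex^'n^'n" where
  "fls_mat_nth X k = (\<chi> i j. fls_nth (X $ i $ j) k)"

definition fls_mat_deriv :: "complex fls^'n^'n \<Rightarrow> complex fls^'n^'n" where
  "fls_mat_deriv X = (\<chi> i j. fls_deriv (X $ i $ j))"

text \<open>The expansion of tr (L dL' - [L, L'] \<Omega>) in a chart, when \<open>X\<close>,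
  \<open>Y\<close> and \<open>W\<close> are those of L, L' and \<Omega>.\<close>

definition cocycle_fls ::
    "complex fls^'n^'n \<Rightarrow> complex fls^'n^'n \<Rightarrow> complex fls^'n^'n \<Rightarrow> complex fls" where
  "cocycle_fls W X Y = trace (X ** fls_mat_deriv Y - (X ** Y - Y ** X) ** W)"

section \<open>Coefficients of products of matrix series\<close>

lemma fls_nth_sum: "fls_nth (\<Sum>i\<in>A. f i) k = (\<Sum>i\<in>A. fls_nth (f i) k)"
  by (induction A rule: infinite_finite_induct) auto

text \<open>The bounds \<open>a\<close> and \<open>b\<close> are any lower bounds for the orders.
  One range of summation then serves all entries of a matrix, so that the coefficients combine into
  matrix products.\<close>

lemma fls_times_nth_bounds:
  fixes f g :: "complex fls"
  assumes "\<And>k. k < a \<Longrightarrow> fls_nth f k = 0" "\<And>k. k < b \<Longrightarrow> fls_nth g k = 0"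
  shows "fls_nth (f * g) n = (\<Sum>i=a..n - b. fls_nth f i * fls_nth g (n - i))"
proof (cases "f = 0 \<or> g = 0")
  case False
  then have "a \<le> fls_subdegree f" "b \<le> fls_subdegree g"
    using assms by (auto intro!: fls_subdegree_geI)
  then show ?thesis
    unfolding fls_times_nth(2)
    by (intro sum.mono_neutral_left) auto
qed auto

lemma fls_mat_nth_mult:
  assumes "\<And>k. k < a \<Longrightarrow> fls_mat_nth X k = 0" "\<And>k. k < b \<Longrightarrow> fls_mat_nth Y k = 0"
  shows "fls_mat_nth (X ** Y) n = (\<Sum>i=a..n - b. fls_mat_nth X i ** fls_mat_nth Y (n - i))"
proof -
  have "fls_nth (X $ i $ l * Y $ l $ j) n = (\<Sum>k=a..n - b. fls_nth (X $ i $ l) k * fls_nth (Y $ l $ j) (n - k))" for i j l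
    using assms by (intro fls_times_nth_bounds) (auto simp: fls_mat_nth_def vec_eq_iff)
  then show ?thesis
    by (simp add: vec_eq_iff fls_mat_nth_def matrix_matrix_mult_def fls_nth_sum sum.swap[of _ "{a..n-b}"])
qed

lemma fls_mat_nth_mult_eq_0:
  assumes "\<And>k. k < a \<Longrightarrow> fls_mat_nth X k = 0" "\<And>k. k < b \<Longrightarrow> fls_mat_nth Y k = 0" "n < a + b"
  shows "fls_mat_nth (X ** Y) n = 0"
  using assms(3) by (subst fls_mat_nth_mult[OF assms(1,2)]) auto

lemma fls_mat_nth_add [simp]: "fls_mat_nth (X + Y) k = fls_mat_nth X k + fls_mat_nth Y k"
  and fls_mat_nth_diff [simp]: "fls_mat_nth (X - Y) k = fls_mat_nth X k - fls_mat_nth Y k"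
  and fls_mat_nth_deriv [simp]: "fls_mat_nth (fls_mat_deriv X) k = of_int (k + 1) *\<^sub>R fls_mat_nth X (k + 1)"
  and fls_nth_trace: "fls_nth (trace X) k = trace (fls_mat_nth X k)"
  by (auto simp: fls_mat_nth_def fls_mat_deriv_def trace_def vec_eq_iff fls_nth_sum scaleR_conv_of_real[where 'a = complex])

text \<open>Differentiation lowers the order by one, so tr (X dY) has order at least
  \<open>a + b - 1\<close>, and tr ([X, Y] W) has order at least \<open>a + b + c\<close>. This
  count is applied at both marked points.\<close>

lemma cocycle_fls_nth_eq_0:
  assumes X: "\<And>k. k < a \<Longrightarrow> fls_mat_nth X k = 0" and Y: "\<And>k. k < b \<Longrightarrow> fls_mat_nth Y k = 0"
    and W: "\<And>k. k < c \<Longrightarrow> fls_mat_nth W k = 0" and n: "n < a + b - 1" "n < a + b + c"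
  shows "fls_nth (cocycle_fls W X Y) n = 0"
proof -
  have B: "fls_mat_nth (X ** Y - Y ** X) k = 0" if "k < a + b" for k
    using fls_mat_nth_mult_eq_0[of a X b Y k] fls_mat_nth_mult_eq_0[of b Y a X k] X Y that by simp
  have "fls_mat_nth (X ** fls_mat_deriv Y) n = 0"
    using X Y n by (intro fls_mat_nth_mult_eq_0[of a _ "b - 1"]) auto
  moreover have "fls_mat_nth ((X ** Y - Y ** X) ** W) n = 0"
    using n by (intro fls_mat_nth_mult_eq_0[OF B W]) auto
  ultimately show ?thesis
    by (simp only: cocycle_fls_def fls_nth_trace fls_mat_nth_diff) (simp add: trace_def)
qed

section \<open>Rank-one residues and regularity at the weak singularities\<close>

lemma matrix_mult_vec_distribs:
  fixes A B :: "complex^'n^'n"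
  shows "(A ** B) *v x = A *v (B *v x)" "(A - B) *v x = A *v x - B *v x" "(A + B) *v x = A *v x + B *v x"
    "A *v (k *s x) = k *s (A *v x)"
  by (simp_all add: matrix_vector_mul_assoc matrix_vector_mult_diff_rdistrib
      matrix_vector_mult_add_rdistrib vec.scale)

lemma outer_product_0 [simp]: "outer_product 0 v = 0"
  by (simp add: outer_product_def vec_eq_iff)

lemma outer_product_simps:
  fixes A B :: "complex^'n^'n"
  shows "outer_product u v *v x = scalar_product v x *s u"
    and "outer_product u v ** A = outer_product u (transpose A *v v)"
    and "A ** outer_product u v = outer_product (A *v u) v"
    and "trace (outer_product u v) = scalar_product v u"
    and "outer_product (k *s u) v = outer_product u (k *s v)"
    and "scalar_product (transpose A *v v) u = scalar_product v (A *v u)"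
proof -
  note defs = outer_product_def matrix_vector_mult_def matrix_matrix_mult_def scalar_product_def
    transpose_def trace_def vec_eq_iff sum_distrib_left sum_distrib_right mult_ac
  show "outer_product u v *v x = scalar_product v x *s u"
    and "outer_product u v ** A = outer_product u (transpose A *v v)"
    and "A ** outer_product u v = outer_product (A *v u) v"
    and "trace (outer_product u v) = scalar_product v u"
    and "outer_product (k *s u) v = outer_product u (k *s v)"
    by (simp_all add: defs)
  show "scalar_product (transpose A *v v) u = scalar_product v (A *v u)"
    by (simp add: defs) (rule sum.swap)
qed

lemma scalar_product_linear:
  fixes u v w :: "complex^'n"
  shows "scalar_product (u + v) w = scalar_product u w + scalar_product v w"
    "scalar_product (u - v) w = scalar_product u w - scalar_product v w"
    "scalar_product (k *s u) w = k * scalar_product u w"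
    "scalar_product w (u + v) = scalar_product w u + scalar_product w v"
    "scalar_product w (u - v) = scalar_product w u - scalar_product w v"
    "scalar_product w (k *s u) = k * scalar_product w u"
  by (simp_all add: scalar_product_def algebra_simps sum.distrib sum_subtractf sum_distrib_left)

lemma outer_product_minus: "- outer_product u v = outer_product u (- v)"
  by (simp add: outer_product_def vec_eq_iff)

lemma scalar_product_minus: "scalar_product (- u) v = - scalar_product u v" for u v :: "complex^'n"
  by (simp add: scalar_product_def sum_negf)

lemma trace_zero [simp]: "trace (0 :: complex^'n^'n) = 0"
  by (simp add: trace_def)

lemma trace_mult_minus:
  fixes A B :: "complex^'n^'n"
  shows "trace (A ** (- B)) = - trace (A ** B)"
  by (simp add: trace_def matrix_matrix_mult_def sum_negf)

text \<open>
  Only the coefficient of \<open>z\<^sup>-\<^sup>1\<close> involves a cancellation between the two parts of the form: both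
  \<open>tr (X dY)\<close> and \<open>tr ([X, Y] W)\<close> contribute \<open>b\<^sup>t Y\<^sub>1 a - c\<^sup>t X\<^sub>1 a\<close> there, the latter because of \<open>d\<^sup>t a = 1\<close>.
\<close>

lemma cocycle_fls_regular:
  fixes a :: "complex^'n"
  assumes X: "\<And>k. k < -1 \<Longrightarrow> fls_mat_nth X k = 0" "fls_mat_nth X (-1) = outer_product a b"
      "scalar_product b a = 0" "fls_mat_nth X 0 *v a = x *s a"
    and Y: "\<And>k. k < -1 \<Longrightarrow> fls_mat_nth Y k = 0" "fls_mat_nth Y (-1) = outer_product a c"
      "scalar_product c a = 0" "fls_mat_nth Y 0 *v a = y *s a"
    and W: "\<And>k. k < -1 \<Longrightarrow> fls_mat_nth W k = 0" "fls_mat_nth W (-1) = outer_product a d"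
      "scalar_product d a = 1" "fls_mat_nth W 0 *v a = w *s a"
    and n: "n < 0"
  shows "fls_nth (cocycle_fls W X Y) n = 0"
proof -
  define B where "B = X ** Y - Y ** X"
  have B': "fls_mat_nth B n = (\<Sum>i=-1..n+1. fls_mat_nth X i ** fls_mat_nth Y (n - i))
     - (\<Sum>i=-1..n+1. fls_mat_nth Y i ** fls_mat_nth X (n - i))" for n
    using fls_mat_nth_mult[of "-1" X "-1" Y n] fls_mat_nth_mult[of "-1" Y "-1" X n] X(1) Y(1) by (simp add: B_def)
  have iv: "{-1..0::int} = {-1,0}" "{-1..1::int} = {-1,0,1}" "{-1.. -1::int} = {-1}" by auto
  \<comment> \<open>The residue of the bracket is
    \<open>X(-1) Y(0) + X(0) Y(-1) - Y(-1) X(0) - Y(0) X(-1)\<close>. The eigenvalue conditions on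
    \<open>a\<close> bring it to the form \<open>a e^t\<close> with this \<open>e\<close>.\<close>
  define e where "e = transpose (fls_mat_nth Y 0) *v b - y *s b + x *s c - transpose (fls_mat_nth X 0) *v c"
  have Bm1: "fls_mat_nth B (-1) = outer_product a e"
  proof -
    have "fls_mat_nth B (-1) = outer_product a (transpose (fls_mat_nth Y 0) *v b) + outer_product (x *s a) c
       - (outer_product a (transpose (fls_mat_nth X 0) *v c) + outer_product (y *s a) b)"
      using X Y by (subst B') (simp add: iv outer_product_simps(2-3) del: transpose_matrix_vector)
    then show ?thesis
      by (simp add: e_def outer_product_def vec_eq_iff algebra_simps del: transpose_matrix_vector)
  qed
  have e: "scalar_product e a = 0"
    using X Y by (simp add: e_def scalar_product_linear outer_product_simps(6) del: transpose_matrix_vector)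
  \<comment> \<open>\<open>a\<close> is an eigenvector of the constant term too:
    \<open>X(1) Y(-1)\<close> and \<open>Y(1) X(-1)\<close> kill it because
    \<open>c^t a = b^t a = 0\<close>, and the products of the eigenvalues \<open>x\<close> and
    \<open>y\<close> cancel.\<close>
  have B0: "fls_mat_nth B 0 *v a =
     (scalar_product b (fls_mat_nth Y 1 *v a) - scalar_product c (fls_mat_nth X 1 *v a)) *s a"
  proof -
    have "fls_mat_nth B 0 *v a =
        y *s (x *s a) + scalar_product b (fls_mat_nth Y 1 *v a) *s a
      - (x *s (y *s a) + scalar_product c (fls_mat_nth X 1 *v a) *s a)"
      using X Y by (subst B') (simp add: iv matrix_mult_vec_distribs outer_product_simps(1))
    then show ?thesis
      by (simp add: vec_eq_iff algebra_simps)
  qed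
  \<comment> \<open>The bracket has no double pole: the product of the two residues is
    \<open>(b^t a) a c^t = 0\<close>, and likewise in the other order.\<close>
  have Bm2: "fls_mat_nth B k = 0" if "k < -1" for k
  proof (cases "k = -2")
    case True
    then show ?thesis using X Y by (subst B') (simp add: iv outer_product_simps)
  next
    case False
    then show ?thesis using that by (subst B') auto
  qed
  have Y': "fls_mat_nth (fls_mat_deriv Y) k = 0" if "k < -2" for k
    using that Y by simp
  have BW: "fls_mat_nth (B ** W) n = (\<Sum>i=-1..n+1. fls_mat_nth B i ** fls_mat_nth W (n - i))"
    using fls_mat_nth_mult[of "-1" B "-1" W n] Bm2 W(1) by simp
  have XY: "fls_mat_nth (X ** fls_mat_deriv Y) n =
     (\<Sum>i=-1..n+2. fls_mat_nth X i ** fls_mat_nth (fls_mat_deriv Y) (n - i))"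
    using fls_mat_nth_mult[of "-1" X "-2" "fls_mat_deriv Y" n] X(1) Y' by simp
  have main: "trace (fls_mat_nth (X ** fls_mat_deriv Y) n) = trace (fls_mat_nth (B ** W) n)"
  proof -
    \<comment> \<open>The derivative of \<open>Y\<close> may have a double pole, so exponents down
      to -3 occur. At -3 and -2 both traces vanish because \<open>b\<close>, \<open>c\<close> and
      \<open>e\<close> annihilate \<open>a\<close>.\<close>
    consider "n = -1" | "n = -2" | "n = -3" | "n < -3" using n by linarith
    then show ?thesis
    proof cases
      case 1
      then show ?thesis using X Y W e unfolding BW XY
        by (simp add: iv trace_add Bm1 B0 outer_product_simps(1-4,6) scalar_product_linear scalar_product_minus
          outer_product_minus trace_mult_minus del: transpose_matrix_vector)
    next
      case 2
      then show ?thesis using X Y W e unfolding BW XY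
        by (simp add: iv trace_add Bm1 B0 outer_product_simps(1-4,6) scalar_product_linear scalar_product_minus
          outer_product_minus trace_mult_minus del: transpose_matrix_vector)
    next
      case 3
      then show ?thesis using X Y W e unfolding BW XY
        by (simp add: iv trace_add Bm1 B0 outer_product_simps(1-4,6) scalar_product_linear scalar_product_minus
          outer_product_minus trace_mult_minus del: transpose_matrix_vector)
    next
      case 4
      then show ?thesis unfolding BW XY by (simp add: trace_def)
    qed
  qed
  then show ?thesis
    by (simp add: cocycle_fls_def fls_nth_trace trace_sub flip: B_def)
qed

section \<open>Formal identities behind the cocycle properties\<close>

lemma fls_mat_deriv_simps:
  fixes X Y :: "complex fls^'n^'n"
  shows "fls_mat_deriv (X + Y) = fls_mat_deriv X + fls_mat_deriv Y"
   and "fls_mat_deriv (X - Y) = fls_mat_deriv X - fls_mat_deriv Y"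
   and "fls_mat_deriv (X ** Y) = fls_mat_deriv X ** Y + X ** fls_mat_deriv Y"
   and "fls_deriv (trace X) = trace (fls_mat_deriv X)"
  by (simp_all add: fls_mat_deriv_def vec_eq_iff trace_def matrix_matrix_mult_def fls_deriv_sum sum.distrib)

lemma mat_mult_nth: "(mat k ** A) $ i $ j = k * (A $ i $ j)" for A :: "'a::comm_semiring_1^'n^'m"
  by (simp add: matrix_matrix_mult_def mat_def if_distrib if_distribR cong: if_cong)

lemma mat_mult_commute:
  fixes A B :: "complex fls^'n^'n"
  shows "trace (mat k ** A) = k * trace A" "A ** (mat k ** B) = mat k ** (A ** B)"
    "mat k ** A - mat k ** B = mat k ** (A - B)" "(mat k ** A) ** B = mat k ** (A ** B)"
  by (simp_all add: trace_def vec_eq_iff mat_mult_nth sum_distrib_left algebra_simps matrix_matrix_mult_def[of A])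
   (simp_all add: matrix_matrix_mult_def[of "mat k ** A"] mat_mult_nth matrix_matrix_mult_def[of A] sum_distrib_left mult_ac)

lemma fls_mat_deriv_const_mult:
  "fls_mat_deriv (mat (fls_const c) ** X) = mat (fls_const c) ** fls_mat_deriv X"
  by (simp add: fls_mat_deriv_def vec_eq_iff mat_mult_nth)

lemma matrix_ring_simps:
  fixes A B C :: "complex fls^'n^'n"
  shows "(A + B) ** C = A ** C + B ** C" "A ** (B + C) = A ** B + A ** C"
    "(A - B) ** C = A ** C - B ** C" "A ** (B - C) = A ** B - A ** C"
    "(A ** B) ** C = A ** (B ** C)"
proof -
  show "(A + B) ** C = A ** C + B ** C" "A ** (B + C) = A ** B + A ** C"
    "(A - B) ** C = A ** C - B ** C" "A ** (B - C) = A ** B - A ** C"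
    by (simp_all add: vec_eq_iff matrix_matrix_mult_def algebra_simps sum.distrib sum_subtractf)
qed (rule matrix_mul_assoc [symmetric])

lemma cocycle_fls_add:
  "cocycle_fls W (X + Y) Z = cocycle_fls W X Z + cocycle_fls W Y Z"
  "cocycle_fls W Z (X + Y) = cocycle_fls W Z X + cocycle_fls W Z Y"
  by (simp_all add: cocycle_fls_def fls_mat_deriv_simps matrix_ring_simps trace_add trace_sub)

lemma cocycle_fls_scale:
  "cocycle_fls W (mat (fls_const c) ** X) Y = fls_const c * cocycle_fls W X Y"
  "cocycle_fls W X (mat (fls_const c) ** Y) = fls_const c * cocycle_fls W X Y"
  by (simp_all add: cocycle_fls_def fls_mat_deriv_const_mult mat_mult_commute del: matrix_mul_assoc)

text \<open>The bracket terms cancel, and the remaining sum is the derivative of tr (X Y), which has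
  no residue.\<close>

lemma fls_residue_cocycle_fls_swap:
  "fls_residue (cocycle_fls W X Y) = - fls_residue (cocycle_fls W Y X)"
proof -
  have "cocycle_fls W X Y + cocycle_fls W Y X = fls_deriv (trace (X ** Y))"
    by (simp add: cocycle_fls_def fls_mat_deriv_simps matrix_ring_simps trace_add trace_sub trace_mul_sym[of Y])
  then show ?thesis
    by (metis add_eq_0_iff fls_residue_add fls_residue_deriv minus_minus)
qed

text \<open>The terms with \<open>W\<close> add up to the trace of the Jacobi sum times
  \<open>W\<close>, which is 0. After cyclic rotations under the trace, the rest is the derivative
  of tr ([X, Y] Z).\<close>

lemma fls_residue_cocycle_fls_jacobi:
  "fls_residue (cocycle_fls W (X ** Y - Y ** X) Z) + fls_residue (cocycle_fls W (Y ** Z - Z ** Y) X)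
    + fls_residue (cocycle_fls W (Z ** X - X ** Z) Y) = 0"
proof -
  have cyclic: "trace (P ** (Q ** R)) = trace (Q ** (R ** P))" for P Q R :: "complex fls^'n^'n"
    by (simp add: trace_mul_sym[of P] matrix_ring_simps)
  have "cocycle_fls W (X ** Y - Y ** X) Z + cocycle_fls W (Y ** Z - Z ** Y) X
    + cocycle_fls W (Z ** X - X ** Z) Y = fls_deriv (trace ((X ** Y - Y ** X) ** Z))"
    using cyclic[of "fls_mat_deriv X" Y Z] cyclic[of "fls_mat_deriv Y" X Z]
      cyclic[of Z X "fls_mat_deriv Y"] cyclic[of Z Y "fls_mat_deriv X"]
    by (simp add: cocycle_fls_def fls_mat_deriv_simps matrix_ring_simps trace_add trace_sub)
  then show ?thesis
    by (metis fls_residue_add fls_residue_deriv)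
qed

section \<open>The cocycle\<close>

lemma deriv_shift: "deriv (\<lambda>z. f (a + z)) = (\<lambda>z. deriv f (a + z))" for f :: "complex \<Rightarrow> complex"
  using DERIV_shift[of f _ _ a] by (simp add: fun_eq_iff deriv_def add.commute)

lemma fls_nonneg_iff: "(\<forall>n<0. fls_nth F n = 0) \<longleftrightarrow> F = 0 \<or> 0 \<le> fls_subdegree F"
  by (auto intro: fls_subdegree_geI)

context charted_surface
begin

text \<open>A relation instead of a function, so that expansions of sums, multiples and brackets are
  assembled from given expansions of the parts.\<close>

definition mat_expansion :: "'a chart \<Rightarrow> 'a \<Rightarrow> ('a \<Rightarrow> complex^'n^'n) \<Rightarrow> complex fls^'n^'n \<Rightarrow> bool" where
  "mat_expansion c p L M \<longleftrightarrow>
     (\<forall>i j. (\<lambda>z. in_chart c (\<lambda>q. L q $ i $ j) (snd c p + z)) has_laurent_expansion M $ i $ j)"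

lemma mat_expansion_coeff:
  assumes "mat_expansion c p L M"
  shows "mat_laurent_coeff c p L k = fls_mat_nth M k"
proof -
  have "laurent_expansion (in_chart c (\<lambda>q. L q $ i $ j)) (snd c p) = M $ i $ j" for i j
    using assms by (intro laurent_expansion_eqI) (simp add: mat_expansion_def)
  then show ?thesis
    by (simp add: mat_laurent_coeff_def fls_mat_nth_def laurent_at_def vec_eq_iff)
qed

lemma mat_expansionI:
  fixes L :: "'a \<Rightarrow> complex^'n^'n"
  assumes "\<And>i j. in_chart c (\<lambda>q. L q $ i $ j) meromorphic_on snd c ` fst c" "p \<in> fst c"
  shows "mat_expansion c p L (\<chi> i j. laurent_at c p (\<lambda>q. L q $ i $ j))"
  using assms unfolding mat_expansion_def meromorphic_on_def' laurent_at_def by simp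

lemma mat_expansion_add:
  "mat_expansion c p X M \<Longrightarrow> mat_expansion c p Y N \<Longrightarrow> mat_expansion c p (\<lambda>q. X q + Y q) (M + N)"
  by (auto simp: mat_expansion_def in_chart_def intro!: laurent_expansion_intros)

lemma mat_expansion_scale:
  "mat_expansion c p X M \<Longrightarrow> mat_expansion c p (\<lambda>q. mat a ** X q) (mat (fls_const a) ** M)"
  by (auto simp: mat_expansion_def in_chart_def mat_mult_nth intro!: laurent_expansion_intros)

lemma mat_expansion_bracket:
  "mat_expansion c p X M \<Longrightarrow> mat_expansion c p Y N \<Longrightarrow> mat_expansion c p (bracket X Y) (M ** N - N ** M)"
  by (auto simp: mat_expansion_def in_chart_def bracket_def matrix_matrix_mult_def intro!: laurent_expansion_intros)

text \<open>A Laurent expansion does not see the value at \<open>p\<close>. This absorbs the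
  convention that elements of the algebra are 0 at the singular points.\<close>

lemma mat_expansion_cong:
  assumes "c \<in> \<Phi>" "p \<in> fst c" and ev: "\<forall>\<^sub>F x in at p. X x = Y x"
  shows "mat_expansion c p X M \<longleftrightarrow> mat_expansion c p Y M"
proof -
  have "\<forall>\<^sub>F z in at (snd c p). X (chart_inv c z) = Y (chart_inv c z)"
    using ev assms by (simp add: eventually_at_chart)
  then have "\<forall>\<^sub>F z in at 0. X (chart_inv c (snd c p + z)) = Y (chart_inv c (snd c p + z))"
    by (simp add: eventually_at_to_0[of _ "snd c p"] add.commute)
  then have "\<forall>\<^sub>F z in at 0. in_chart c (\<lambda>q. X q $ i $ j) (snd c p + z) = in_chart c (\<lambda>q. Y q $ i $ j) (snd c p + z)" for i j
    by eventually_elim (simp add: in_chart_def)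
  note this[THEN has_laurent_expansion_cong, OF refl]
  then show ?thesis by (simp add: mat_expansion_def)
qed

text \<open>In \<open>mat_differential\<close> the derivative is taken at
  \<open>snd c (chart_inv c z)\<close>, which is known to be \<open>z\<close> only for
  \<open>z\<close> in the image of the chart.\<close>

lemma in_chart_cocycle_form:
  assumes "c \<in> \<Phi>" "z \<in> snd c ` fst c"
  shows "in_chart c (cocycle_form \<Omega> L L' c) z =
    (\<Sum>i\<in>UNIV. (\<Sum>k\<in>UNIV. in_chart c (\<lambda>q. L q $ i $ k) z * deriv (in_chart c (\<lambda>q. L' q $ k $ i)) z)
      - (\<Sum>k\<in>UNIV. in_chart c (\<lambda>q. bracket L L' q $ i $ k) z * in_chart c (\<lambda>q. \<Omega> c q $ k $ i) z))"
  using assms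
  by (simp add: in_chart_def cocycle_form_def trace_def matrix_matrix_mult_def mat_differential_def)

text \<open>The bridge from the surface to formal series: orders and residues of the form become
  statements about the coefficients of \<open>cocycle_fls\<close>.\<close>

lemma cocycle_form_expansion:
  assumes c: "c \<in> \<Phi>" "p \<in> fst c"
    and L: "mat_expansion c p L X" and L': "mat_expansion c p L' Y" and \<Omega>: "mat_expansion c p (\<Omega> c) W"
  shows "(\<lambda>z. in_chart c (cocycle_form \<Omega> L L' c) (snd c p + z)) has_laurent_expansion cocycle_fls W X Y"
proof -
  define a where "a = snd c p"
  have B: "mat_expansion c p (bracket L L') (X ** Y - Y ** X)"
    using L L' by (rule mat_expansion_bracket)
  have dL': "(\<lambda>z. deriv (in_chart c (\<lambda>q. L' q $ k $ i)) (a + z)) has_laurent_expansion fls_deriv (Y $ k $ i)" for k i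
    using has_laurent_expansion_deriv[of "\<lambda>z. in_chart c (\<lambda>q. L' q $ k $ i) (a + z)" "Y $ k $ i"] L'
    by (simp add: mat_expansion_def a_def deriv_shift[of "in_chart c (\<lambda>q. L' q $ k $ i)"])
  have "(\<lambda>z. \<Sum>i\<in>UNIV. (\<Sum>k\<in>UNIV. in_chart c (\<lambda>q. L q $ i $ k) (a + z) * deriv (in_chart c (\<lambda>q. L' q $ k $ i)) (a + z))
      - (\<Sum>k\<in>UNIV. in_chart c (\<lambda>q. bracket L L' q $ i $ k) (a + z) * in_chart c (\<lambda>q. \<Omega> c q $ k $ i) (a + z)))
      has_laurent_expansion
      (\<Sum>i\<in>UNIV. (\<Sum>k\<in>UNIV. X $ i $ k * fls_deriv (Y $ k $ i)) - (\<Sum>k\<in>UNIV. (X ** Y - Y ** X) $ i $ k * W $ k $ i))"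
    using L B \<Omega> dL' unfolding mat_expansion_def a_def
    by (intro laurent_expansion_intros) blast+
  also have "(\<Sum>i\<in>UNIV. (\<Sum>k\<in>UNIV. X $ i $ k * fls_deriv (Y $ k $ i)) - (\<Sum>k\<in>UNIV. (X ** Y - Y ** X) $ i $ k * W $ k $ i))
      = cocycle_fls W X Y"
    by (simp add: cocycle_fls_def trace_def matrix_matrix_mult_def fls_mat_deriv_def)
  finally show ?thesis
  proof (rule has_laurent_expansion_cong[THEN iffD1, rotated -1])
    have "\<forall>\<^sub>F z in at 0. a + z \<in> snd c ` fst c"
      using eventually_at_chart_image[OF c] by (simp add: eventually_at_to_0[of _ "snd c p"] add.commute a_def)
    then show "\<forall>\<^sub>F z in at 0. (\<Sum>i\<in>UNIV. (\<Sum>k\<in>UNIV. in_chart c (\<lambda>q. L q $ i $ k) (a + z) * deriv (in_chart c (\<lambda>q. L' q $ k $ i)) (a + z))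
      - (\<Sum>k\<in>UNIV. in_chart c (\<lambda>q. bracket L L' q $ i $ k) (a + z) * in_chart c (\<lambda>q. \<Omega> c q $ k $ i) (a + z)))
      = in_chart c (cocycle_form \<Omega> L L' c) (snd c p + z)"
      by eventually_elim (simp add: in_chart_cocycle_form[OF c(1)] a_def)
  qed simp
qed

text \<open>Chain rule along the transition function; by it dL' transforms as a 1-form.\<close>

lemma differential_transition:
  assumes c: "c \<in> \<Phi>" "p \<in> fst c" and d: "d \<in> \<Phi>" "p \<in> fst d"
    and f: "in_chart d f analytic_on {snd d p}"
  shows "deriv (in_chart c f) (snd c p) = deriv (\<lambda>z. snd d (chart_inv c z)) (snd c p) * deriv (in_chart d f) (snd d p)"
proof -
  define \<phi> where "\<phi> = (\<lambda>z. snd d (chart_inv c z))"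
  have \<phi>p: "\<phi> (snd c p) = snd d p" using c by (simp add: \<phi>_def)
  have "\<forall>\<^sub>F x in at p. x \<in> fst d"
    using d open_chart_domain[of d] by (intro eventually_at_in_open') auto
  then have "\<forall>\<^sub>F z in at (snd c p). chart_inv c z \<in> fst d"
    by (simp add: eventually_at_chart[OF c])
  then have "\<forall>\<^sub>F z in nhds (snd c p). chart_inv c z \<in> fst d"
    using c d by (simp add: eventually_nhds_conv_at)
  then have "\<forall>\<^sub>F z in nhds (snd c p). in_chart c f z = (in_chart d f \<circ> \<phi>) z"
    by eventually_elim (use d in \<open>simp add: in_chart_def \<phi>_def\<close>)
  then have "deriv (in_chart c f) (snd c p) = deriv (in_chart d f \<circ> \<phi>) (snd c p)"
    by (rule deriv_cong_ev) simp
  also have "\<dots> = deriv (in_chart d f) (\<phi> (snd c p)) * deriv \<phi> (snd c p)"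
    using transition_regular(1)[OF c d] f unfolding \<phi>p[symmetric]
    by (intro deriv_chain) (auto simp: \<phi>_def analytic_on_imp_differentiable_at)
  finally show ?thesis using c by (simp add: \<phi>_def mult.commute)
qed

end

section \<open>Regularity of the form and the cocycle identities\<close>

locale lax_data = charted_surface \<Phi> for \<Phi> :: "('a::t2_space) chart set" +
  fixes Pp Pm :: 'a and I :: "nat set" and \<gamma> :: "nat \<Rightarrow> 'a" and \<alpha> :: "nat \<Rightarrow> complex^'n"
    and \<Omega> :: "('a, complex^'n^'n) form"
  assumes finite_I: "finite I" and \<gamma>: "Pp \<notin> \<gamma> ` I" "Pm \<notin> \<gamma> ` I"
    and lax_form: "lax_form \<Phi> Pp Pm I \<gamma> \<alpha> \<Omega>"
begin

abbreviation "S \<equiv> singular_points Pp Pm I \<gamma>"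
abbreviation "V \<equiv> lax_gl \<Phi> Pp Pm I \<gamma> \<alpha>"

lemma finite_S: "finite S"
  using finite_I by (simp add: singular_points_def)

lemma eventually_not_S: "\<forall>\<^sub>F x in at p. x \<notin> S"
proof -
  have "\<forall>\<^sub>F x in at p. x \<in> - (S - {p})"
    using finite_S by (intro eventually_at_in_open' open_Compl finite_imp_closed) auto
  then show ?thesis
    using eventually_neq_at_within[of p p UNIV] by eventually_elim auto
qed

lemma lax_expansion:
  assumes "L \<in> V" "c \<in> \<Phi>" "p \<in> fst c"
  shows "mat_expansion c p L (\<chi> i j. laurent_at c p (\<lambda>q. L q $ i $ j))"
  using assms by (intro mat_expansionI) (auto simp: lax_gl_def meromorphic_fun_def)

lemma form_expansion:
  assumes "c \<in> \<Phi>" "p \<in> fst c"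
  shows "mat_expansion c p (\<Omega> c) (\<chi> i j. laurent_at c p (\<lambda>q. \<Omega> c q $ i $ j))"
  using assms lax_form by (intro mat_expansionI) (auto simp: lax_form_def meromorphic_form_def)

lemma lax_cocycle_form_expansion:
  assumes "c \<in> \<Phi>" "p \<in> fst c" "L \<in> V" "L' \<in> V"
  obtains G where "(\<lambda>z. in_chart c (cocycle_form \<Omega> L L' c) (snd c p + z)) has_laurent_expansion G"
  using that cocycle_form_expansion[where \<Omega> = \<Omega>, OF assms(1,2) lax_expansion[OF assms(3,1,2)]
      lax_expansion[OF assms(4,1,2)] form_expansion[OF assms(1,2)]] by blast

text \<open>Under a change of chart dL' and \<Omega> acquire the same factor, the derivative of the
  transition function, while L and [L, L'] are functions. Off \<open>S\<close> all ingredients are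
  analytic, and the existence of an expansion at every point gives meromorphy.\<close>

lemma meromorphic_cocycle_form:
  assumes L: "L \<in> V" and L': "L' \<in> V"
  shows "meromorphic_form \<Phi> S (cocycle_form \<Omega> L L')"
proof -
  have Lan: "in_chart c (\<lambda>q. X q $ i $ j) analytic_on {snd c p}" if "X \<in> V" "c \<in> \<Phi>" "p \<in> fst c - S" for X c p i j
  proof -
    have "in_chart c (\<lambda>q. X q $ i $ j) analytic_on snd c ` (fst c - S)"
      using that by (simp add: lax_gl_def meromorphic_fun_def)
    then show ?thesis by (rule analytic_on_subset) (use that in auto)
  qed
  have Oan: "in_chart c (\<lambda>q. \<Omega> c q $ i $ j) analytic_on {snd c p}" if "c \<in> \<Phi>" "p \<in> fst c - S" for c p i j
  proof -
    have "in_chart c (\<lambda>q. \<Omega> c q $ i $ j) analytic_on snd c ` (fst c - S)"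
      using that lax_form by (simp add: lax_form_def meromorphic_form_def)
    then show ?thesis by (rule analytic_on_subset) (use that in auto)
  qed
  have an: "in_chart c (cocycle_form \<Omega> L L' c) analytic_on {snd c p}" if c: "c \<in> \<Phi>" "p \<in> fst c - S" for c p
  proof -
    have "\<forall>\<^sub>F z in nhds (snd c p). z \<in> snd c ` fst c"
      using c open_chart_image by (intro eventually_nhds_in_open) auto
    then have ev: "\<forall>\<^sub>F z in nhds (snd c p). in_chart c (cocycle_form \<Omega> L L' c) z =
      (\<Sum>i\<in>UNIV. (\<Sum>k\<in>UNIV. in_chart c (\<lambda>q. L q $ i $ k) z * deriv (in_chart c (\<lambda>q. L' q $ k $ i)) z)
      - (\<Sum>k\<in>UNIV. in_chart c (\<lambda>q. bracket L L' q $ i $ k) z * in_chart c (\<lambda>q. \<Omega> c q $ k $ i) z))"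
      by eventually_elim (rule in_chart_cocycle_form[OF c(1)])
    have "in_chart c (\<lambda>q. bracket L L' q $ i $ k) analytic_on {snd c p}" for i k
      using Lan[OF L c] Lan[OF L' c]
      by (auto simp: in_chart_def bracket_def matrix_matrix_mult_def intro!: analytic_intros)
    then have "(\<lambda>z. \<Sum>i\<in>UNIV. (\<Sum>k\<in>UNIV. in_chart c (\<lambda>q. L q $ i $ k) z * deriv (in_chart c (\<lambda>q. L' q $ k $ i)) z)
      - (\<Sum>k\<in>UNIV. in_chart c (\<lambda>q. bracket L L' q $ i $ k) z * in_chart c (\<lambda>q. \<Omega> c q $ k $ i) z)) analytic_on {snd c p}"
      using Lan[OF L c] Lan[OF L' c] Oan[OF c] by (intro analytic_intros analytic_deriv)
    then show ?thesis using analytic_at_cong[OF ev refl] by blast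
  qed
  show ?thesis
    unfolding meromorphic_form_def
  proof (intro conjI ballI)
    fix c assume c: "c \<in> \<Phi>"
    show "in_chart c (cocycle_form \<Omega> L L' c) analytic_on snd c ` (fst c - S)"
      by (subst analytic_on_analytic_at) (use an[OF c] in auto)
    show "in_chart c (cocycle_form \<Omega> L L' c) meromorphic_on snd c ` fst c"
      unfolding meromorphic_on_def using lax_cocycle_form_expansion[OF c _ L L'] by blast
    fix d p assume d: "d \<in> \<Phi>" and p: "p \<in> fst c \<inter> fst d - S"
    define \<delta> where "\<delta> = deriv (\<lambda>z. snd d (chart_inv c z)) (snd c p)"
    have "mat_differential L' c p $ i $ j = \<delta> * mat_differential L' d p $ i $ j" for i j
      unfolding mat_differential_def \<delta>_def using differential_transition[OF c _ d] Lan[OF L' d] p by simp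
    moreover have "\<Omega> c p $ i $ j = \<delta> * \<Omega> d p $ i $ j" for i j
      using lax_form c d p unfolding lax_form_def meromorphic_form_def \<delta>_def by blast
    ultimately show "cocycle_form \<Omega> L L' c p = \<delta> * cocycle_form \<Omega> L L' d p"
      by (simp add: cocycle_form_def trace_def matrix_matrix_mult_def sum_distrib_left algebra_simps sum_subtractf)
  qed
qed

text \<open>Off \<open>S\<close> the coefficient is analytic. At a weak singularity the local
  conditions on L, L' and \<Omega> are the hypotheses of \<open>cocycle_fls_regular\<close> with
  \<open>\<alpha> s\<close> as the common vector.\<close>

lemma cocycle_form_regular:
  assumes L: "L \<in> V" and L': "L' \<in> V" and p: "p \<notin> {Pp, Pm}"
  shows "form_regular_at \<Phi> (cocycle_form \<Omega> L L') p"
  unfolding form_regular_at_def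
proof
  fix c assume cp: "c \<in> charts_at \<Phi> p"
  then have c: "c \<in> \<Phi>" "p \<in> fst c" by (auto simp: charts_at_def)
  show "laurent_at c p (cocycle_form \<Omega> L L' c) = 0 \<or> 0 \<le> fls_subdegree (laurent_at c p (cocycle_form \<Omega> L L' c))"
  proof (cases "p \<in> S")
    case False
    have "in_chart c (cocycle_form \<Omega> L L' c) analytic_on snd c ` (fst c - S)"
      using meromorphic_cocycle_form[OF L L'] c by (simp add: meromorphic_form_def)
    then have "in_chart c (cocycle_form \<Omega> L L' c) analytic_on {snd c p}"
      by (rule analytic_on_subset) (use c False in auto)
    then obtain G where "(\<lambda>z. in_chart c (cocycle_form \<Omega> L L' c) (snd c p + z)) has_fps_expansion G"
      using analytic_at_imp_has_fps_expansion by blast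
    then have "laurent_at c p (cocycle_form \<Omega> L L' c) = fps_to_fls G"
      unfolding laurent_at_def by (intro laurent_expansion_eqI has_laurent_expansion_fps)
    then show ?thesis by (simp add: fls_subdegree_fls_to_fps)
  next
    case True
    then obtain s where s: "s \<in> I" "p = \<gamma> s" using p by (auto simp: singular_points_def)
    define X where "X = (\<chi> i j. laurent_at c p (\<lambda>q. L q $ i $ j))"
    define Y where "Y = (\<chi> i j. laurent_at c p (\<lambda>q. L' q $ i $ j))"
    define W where "W = (\<chi> i j. laurent_at c p (\<lambda>q. \<Omega> c q $ i $ j))"
    have X: "mat_expansion c p L X" and Y: "mat_expansion c p L' Y" and W: "mat_expansion c p (\<Omega> c) W"
      unfolding X_def Y_def W_def using L L' c by (intro lax_expansion form_expansion; simp)+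
    have cs: "c \<in> charts_at \<Phi> (\<gamma> s)" using cp s by simp
    have "(\<forall>k < -1. fls_mat_nth X k = 0) \<and>
        (\<exists>\<beta>. fls_mat_nth X (-1) = outer_product (\<alpha> s) \<beta> \<and> scalar_product \<beta> (\<alpha> s) = 0) \<and>
        (\<exists>\<kappa>. fls_mat_nth X 0 *v \<alpha> s = \<kappa> *s \<alpha> s)"
      using L s cs by (simp add: lax_gl_def flip: mat_expansion_coeff[OF X])
    then obtain b x where b: "\<And>k. k < -1 \<Longrightarrow> fls_mat_nth X k = 0"
      "fls_mat_nth X (-1) = outer_product (\<alpha> s) b" "scalar_product b (\<alpha> s) = 0"
      "fls_mat_nth X 0 *v \<alpha> s = x *s \<alpha> s"
      by blast
    have "(\<forall>k < -1. fls_mat_nth Y k = 0) \<and>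
        (\<exists>\<beta>. fls_mat_nth Y (-1) = outer_product (\<alpha> s) \<beta> \<and> scalar_product \<beta> (\<alpha> s) = 0) \<and>
        (\<exists>\<kappa>. fls_mat_nth Y 0 *v \<alpha> s = \<kappa> *s \<alpha> s)"
      using L' s cs by (simp add: lax_gl_def flip: mat_expansion_coeff[OF Y])
    then obtain b' x' where b': "\<And>k. k < -1 \<Longrightarrow> fls_mat_nth Y k = 0"
      "fls_mat_nth Y (-1) = outer_product (\<alpha> s) b'" "scalar_product b' (\<alpha> s) = 0"
      "fls_mat_nth Y 0 *v \<alpha> s = x' *s \<alpha> s"
      by blast
    have "(\<forall>k < -1. fls_mat_nth W k = 0) \<and>
        (\<exists>\<beta>. fls_mat_nth W (-1) = outer_product (\<alpha> s) \<beta> \<and> scalar_product \<beta> (\<alpha> s) = 1) \<and>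
        (\<exists>\<kappa>. fls_mat_nth W 0 *v \<alpha> s = \<kappa> *s \<alpha> s)"
      using lax_form s cs by (simp add: lax_form_def flip: mat_expansion_coeff[OF W])
    then obtain d y where d: "\<And>k. k < -1 \<Longrightarrow> fls_mat_nth W k = 0"
      "fls_mat_nth W (-1) = outer_product (\<alpha> s) d" "scalar_product d (\<alpha> s) = 1"
      "fls_mat_nth W 0 *v \<alpha> s = y *s \<alpha> s"
      by blast
    have "laurent_at c p (cocycle_form \<Omega> L L' c) = cocycle_fls W X Y"
      unfolding laurent_at_def by (intro laurent_expansion_eqI cocycle_form_expansion c X Y W)
    then show ?thesis
      using cocycle_fls_regular[of X "\<alpha> s" b x Y b' x' W d y] b b' d
      by (simp add: fls_nonneg_iff[symmetric])
  qed
qed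

text \<open>All residues are read in the one chart at \<open>Pp\<close> that
  \<open>form_residue\<close> selects, so each identity becomes one between residues of the series
  \<open>cocycle_fls\<close>.\<close>

lemma two_cocycle_residue:
  "two_cocycle V (\<lambda>L L'. form_residue \<Phi> Pp (cocycle_form \<Omega> L L'))"
proof -
  define c where "c = (SOME c. c \<in> charts_at \<Phi> Pp)"
  have c: "c \<in> \<Phi>" "Pp \<in> fst c"
    using some_in_eq[of "charts_at \<Phi> Pp"] charts_at_nonempty[of Pp] by (auto simp: c_def charts_at_def)
  define M :: "('a \<Rightarrow> complex^'n^'n) \<Rightarrow> complex fls^'n^'n" where "M L = (\<chi> i j. laurent_at c Pp (\<lambda>q. L q $ i $ j))" for L
  define W where "W = (\<chi> i j. laurent_at c Pp (\<lambda>q. \<Omega> c q $ i $ j))"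
  have M: "mat_expansion c Pp L (M L)" if "L \<in> V" for L
    unfolding M_def using that c by (rule lax_expansion)
  have W: "mat_expansion c Pp (\<Omega> c) W"
    unfolding W_def using c by (rule form_expansion)
  have res: "form_residue \<Phi> Pp (cocycle_form \<Omega> L L') = fls_residue (cocycle_fls W X Y)"
    if "mat_expansion c Pp L X" "mat_expansion c Pp L' Y" for L L' X Y
    unfolding form_residue_def Let_def c_def[symmetric]
    using that by (intro has_laurent_expansion_residue cocycle_form_expansion c W)
  show ?thesis
    unfolding two_cocycle_def
  proof (intro conjI ballI allI)
    fix X Y assume XY: "X \<in> V" "Y \<in> V"
    fix a
    show "form_residue \<Phi> Pp (cocycle_form \<Omega> (\<lambda>p. mat a ** X p) Y) = a * form_residue \<Phi> Pp (cocycle_form \<Omega> X Y)"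
      using XY by (simp add: res[OF mat_expansion_scale[OF M] M] res[OF M M] cocycle_fls_scale)
    show "form_residue \<Phi> Pp (cocycle_form \<Omega> X (\<lambda>p. mat a ** Y p)) = a * form_residue \<Phi> Pp (cocycle_form \<Omega> X Y)"
      using XY by (simp add: res[OF M mat_expansion_scale[OF M]] res[OF M M] cocycle_fls_scale)
  next
    fix X Y Z assume XYZ: "X \<in> V" "Y \<in> V" "Z \<in> V"
    show "form_residue \<Phi> Pp (cocycle_form \<Omega> (\<lambda>p. X p + Y p) Z) =
       form_residue \<Phi> Pp (cocycle_form \<Omega> X Z) + form_residue \<Phi> Pp (cocycle_form \<Omega> Y Z)"
      using XYZ by (simp add: res[OF mat_expansion_add[OF M M] M] res[OF M M] cocycle_fls_add)
    show "form_residue \<Phi> Pp (cocycle_form \<Omega> Z (\<lambda>p. X p + Y p)) =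
       form_residue \<Phi> Pp (cocycle_form \<Omega> Z X) + form_residue \<Phi> Pp (cocycle_form \<Omega> Z Y)"
      using XYZ by (simp add: res[OF M mat_expansion_add[OF M M]] res[OF M M] cocycle_fls_add)
    show "form_residue \<Phi> Pp (cocycle_form \<Omega> (bracket X Y) Z) + form_residue \<Phi> Pp (cocycle_form \<Omega> (bracket Y Z) X)
      + form_residue \<Phi> Pp (cocycle_form \<Omega> (bracket Z X) Y) = 0"
      using XYZ fls_residue_cocycle_fls_jacobi[of W "M X" "M Y" "M Z"]
      by (simp only: res[OF mat_expansion_bracket[OF M M] M])
  next
    fix X Y assume XY: "X \<in> V" "Y \<in> V"
    show "form_residue \<Phi> Pp (cocycle_form \<Omega> X Y) = - form_residue \<Phi> Pp (cocycle_form \<Omega> Y X)"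
      using XY fls_residue_cocycle_fls_swap[of W "M X" "M Y"] by (simp only: res[OF M M])
  qed
qed

end

section \<open>Locality\<close>

lemma fls_mat_nth_lower_bound: "\<exists>b. \<forall>k<b. fls_mat_nth W k = 0"
proof -
  \<comment> \<open>A zero entry counts with \<open>fls_subdegree 0 = 0\<close>; the minimum stays a
    valid lower bound.\<close>
  define b where "b = Min (range (\<lambda>(i, j). fls_subdegree (W $ i $ j)))"
  have "b \<le> fls_subdegree (W $ i $ j)" for i j
    unfolding b_def by (intro Min_le) (auto intro: image_eqI[of _ _ "(i, j)"])
  then have "fls_mat_nth W k = 0" if "k < b" for k
    using that by (force simp: fls_mat_nth_def vec_eq_iff intro!: fls_eq0_below_subdegree less_le_trans[OF that])
  then show ?thesis by blast
qed

lemma mat_vector_mult: "mat k *v v = k *s v" for v :: "'a::comm_semiring_1^'n"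
  by (simp add: vec_eq_iff matrix_vector_mult_def mat_def if_distrib if_distribR cong: if_cong)

lemma order_at_least_nth:
  "order_at_least \<Phi> p m f \<Longrightarrow> c \<in> charts_at \<Phi> p \<Longrightarrow> k < m \<Longrightarrow> fls_nth (laurent_at c p f) k = 0"
  by (force simp: order_at_least_def)

locale lax_data_kn = lax_data \<Phi> Pp Pm I \<gamma> \<alpha> \<Omega>
  for \<Phi> :: "('a::t2_space) chart set" and Pp Pm I \<gamma> and \<alpha> :: "nat \<Rightarrow> complex^'n" and \<Omega> +
  fixes g :: nat and A :: "int \<Rightarrow> 'a \<Rightarrow> complex"
  assumes compact: "compact (UNIV :: 'a set)" and connected: "connected (UNIV :: 'a set)"
    and P_neq: "Pp \<noteq> Pm" and kn: "kn_basis \<Phi> g Pp Pm A"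
begin

abbreviation "\<G> \<equiv> lax_gl_homogeneous \<Phi> g Pp Pm I \<gamma> \<alpha> A"

lemma kn_meromorphic: "c \<in> \<Phi> \<Longrightarrow> in_chart c (A m) meromorphic_on snd c ` fst c"
  and kn_analytic: "c \<in> \<Phi> \<Longrightarrow> in_chart c (A m) analytic_on snd c ` (fst c - {Pp, Pm})"
  and kn_marked: "A m Pp = 0" "A m Pm = 0"
  using kn by (auto simp: kn_basis_def meromorphic_fun_def)

lemma kn_expansion:
  assumes "c \<in> \<Phi>" "p \<in> fst c"
  shows "(\<lambda>z. in_chart c (A m) (snd c p + z)) has_laurent_expansion laurent_at c p (A m)"
  using kn_meromorphic[OF assms(1), of m] assms(2) unfolding meromorphic_on_def' laurent_at_def by auto

text \<open>The bound \<open>- m - int g - 1\<close> at \<open>Pm\<close> covers all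
  \<open>m\<close> at once: it is the exact order in the range from \<open>- int g\<close> to -1 and
  a weaker bound otherwise. For \<open>m = 0\<close> the function is 1 around a marked point and
  normalised to 0 at the point itself, so its expansion is 1.\<close>

lemma kn_order:
  assumes c: "c \<in> charts_at \<Phi> p" and p: "p = Pp \<and> k < m \<or> p = Pm \<and> k < - m - int g - 1"
  shows "fls_nth (laurent_at c p (A m)) k = 0"
proof (cases "m = 0")
  case True
  have c': "c \<in> \<Phi>" "p \<in> fst c" using c by (auto simp: charts_at_def)
  have "\<forall>\<^sub>F x in at p. x \<in> - ({Pp, Pm} - {p})"
    by (intro eventually_at_in_open' open_Compl finite_imp_closed) auto
  then have "\<forall>\<^sub>F x in at p. A 0 x = 1"
    using eventually_neq_at_within[of p p UNIV]
    by eventually_elim (use kn in \<open>auto simp: kn_basis_def\<close>)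
  then have "\<forall>\<^sub>F z in at (snd c p). in_chart c (A 0) z = 1"
    by (simp add: eventually_at_chart[OF c'] in_chart_def)
  then have "\<forall>\<^sub>F z in at 0. in_chart c (A 0) (snd c p + z) = 1"
    by (simp add: eventually_at_to_0[of _ "snd c p"] add.commute)
  then have "(\<lambda>z. in_chart c (A 0) (snd c p + z)) has_laurent_expansion 1"
    using has_laurent_expansion_cong[of _ "\<lambda>_. 1"] by simp
  then have "laurent_at c p (A m) = 1"
    unfolding laurent_at_def True by (rule laurent_expansion_eqI)
  then show ?thesis using p True by auto
next
  case False
  then consider "m > 0 \<or> m < - int g" | "- int g \<le> m \<and> m < 0" by linarith
  then have "has_order \<Phi> Pp m (A m) \<and>
      (has_order \<Phi> Pm (- m - int g) (A m) \<or> has_order \<Phi> Pm (- m - int g - 1) (A m))"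
    using kn unfolding kn_basis_def by cases blast+
  then show ?thesis
    using c p by (auto simp: has_order_def intro!: fls_eq0_below_subdegree)
qed

text \<open>The scalar summand is switched off on the finite set \<open>S\<close>. Expansions do not
  notice this, so they are the sums of those of the two summands.\<close>

lemma homogeneous_decomposition:
  assumes "L \<in> \<G> m"
  shows "\<exists>X a. X \<in> V \<and> X \<in> lax_sl_homogeneous \<Phi> g Pp Pm I \<gamma> \<alpha> m \<and>
    L = (\<lambda>p. X p + (if p \<in> S then 0 else mat (a * A m p))) \<and>
    (\<forall>c\<in>\<Phi>. \<forall>p\<in>fst c. mat_expansion c p L
        ((\<chi> i j. laurent_at c p (\<lambda>q. X q $ i $ j)) + mat (fls_const a * laurent_at c p (A m))))"
proof -
  obtain X a where X: "X \<in> lax_sl_homogeneous \<Phi> g Pp Pm I \<gamma> \<alpha> m"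
    and L: "L = (\<lambda>p. X p + (if p \<in> S then 0 else mat (a * A m p)))"
    using assms unfolding lax_gl_homogeneous_def by blast
  have XV: "X \<in> V" using X by (simp add: lax_sl_homogeneous_def lax_sl_def)
  have "mat_expansion c p L
        ((\<chi> i j. laurent_at c p (\<lambda>q. X q $ i $ j)) + mat (fls_const a * laurent_at c p (A m)))"
    if c: "c \<in> \<Phi>" "p \<in> fst c" for c p
  proof -
    have "mat_expansion c p (\<lambda>q. mat (a * A m q)) (mat (fls_const a * laurent_at c p (A m)) :: complex fls^'n^'n)"
      unfolding mat_expansion_def mat_def in_chart_def
      using has_laurent_expansion_cmult_left[OF kn_expansion[OF c, of m], of a]
      by (auto simp: in_chart_def)
    then have sum: "mat_expansion c p (\<lambda>q. X q + mat (a * A m q))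
        ((\<chi> i j. laurent_at c p (\<lambda>q. X q $ i $ j)) + mat (fls_const a * laurent_at c p (A m)))"
      by (intro mat_expansion_add lax_expansion XV c)
    have ev: "\<forall>\<^sub>F x in at p. L x = X x + mat (a * A m x)"
      using eventually_not_S[of p] by eventually_elim (simp add: L)
    show ?thesis using sum by (simp only: mat_expansion_cong[OF c ev])
  qed
  then show ?thesis using XV X L by blast
qed

text \<open>At \<open>Pm\<close> the trace-free part has order at least \<open>- m - int g\<close>;
  the additional -1 accommodates the scalar part.\<close>

lemma homogeneous_order:
  assumes L: "L \<in> \<G> m" and c: "c \<in> charts_at \<Phi> p"
    and p: "p = Pp \<and> b = m \<or> p = Pm \<and> b = - m - int g - 1"
  shows "\<exists>M. mat_expansion c p L M \<and> (\<forall>k<b. fls_mat_nth M k = 0)"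
proof -
  have c': "c \<in> \<Phi>" "p \<in> fst c" using c by (auto simp: charts_at_def)
  obtain X a where X: "X \<in> lax_sl_homogeneous \<Phi> g Pp Pm I \<gamma> \<alpha> m"
    and L: "mat_expansion c p L
        ((\<chi> i j. laurent_at c p (\<lambda>q. X q $ i $ j)) + mat (fls_const a * laurent_at c p (A m)))"
    using homogeneous_decomposition[OF L] c' by blast
  have "fls_nth (laurent_at c p (\<lambda>q. X q $ i $ j)) k = 0" if "k < b" for i j k
  proof -
    have "order_at_least \<Phi> Pp m (\<lambda>p. X p $ i $ j)" "order_at_least \<Phi> Pm (- m - int g) (\<lambda>p. X p $ i $ j)"
      using X by (auto simp: lax_sl_homogeneous_def)
    then show ?thesis using p c that order_at_least_nth by fastforce
  qed
  moreover have "fls_nth (laurent_at c p (A m)) k = 0" if "k < b" for k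
    using p that by (intro kn_order[OF c]) auto
  ultimately show ?thesis
    using L by (intro exI conjI) (auto simp: fls_mat_nth_def vec_eq_iff mat_def)
qed

text \<open>\<open>A m\<close> is holomorphic at the weak singularities, so adding its multiple of
  the identity leaves the polar part unchanged and only shifts the eigenvalue on
  \<open>\<alpha> s\<close>.\<close>

lemma homogeneous_subset: "\<G> m \<subseteq> V"
proof
  fix L assume "L \<in> \<G> m"
  then obtain X a where X: "X \<in> V"
    and L: "L = (\<lambda>p. X p + (if p \<in> S then 0 else mat (a * A m p)))"
    and exp: "\<And>c p. c \<in> \<Phi> \<Longrightarrow> p \<in> fst c \<Longrightarrow> mat_expansion c p L
        ((\<chi> i j. laurent_at c p (\<lambda>q. X q $ i $ j)) + mat (fls_const a * laurent_at c p (A m)))"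
    using homogeneous_decomposition by blast
  show "L \<in> V"
    unfolding lax_gl_def mem_Collect_eq
  proof (intro conjI allI ballI impI)
    fix i j
    have Xij: "meromorphic_fun \<Phi> S (\<lambda>p. X p $ i $ j)" using X by (simp add: lax_gl_def)
    show "meromorphic_fun \<Phi> S (\<lambda>p. L p $ i $ j)"
      unfolding meromorphic_fun_def
    proof (intro conjI ballI)
      fix c assume c: "c \<in> \<Phi>"
      show "in_chart c (\<lambda>p. L p $ i $ j) meromorphic_on snd c ` fst c"
        unfolding meromorphic_on_def using exp[OF c] unfolding mat_expansion_def by blast
      show "in_chart c (\<lambda>p. L p $ i $ j) analytic_on snd c ` (fst c - S)"
      proof (subst analytic_on_analytic_at, safe)
        fix p assume p: "p \<in> fst c" "p \<notin> S"
        have "open (fst c - S)"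
          using open_chart_domain[OF c] finite_S by (intro open_Diff finite_imp_closed)
        then have "\<forall>\<^sub>F x in at p. x \<in> fst c - S"
          using p by (intro eventually_at_in_open') auto
        then have "\<forall>\<^sub>F z in at (snd c p). chart_inv c z \<in> fst c - S"
          by (simp add: eventually_at_chart[OF c p(1)])
        then have "\<forall>\<^sub>F z in nhds (snd c p). chart_inv c z \<in> fst c - S"
          using c p by (simp add: eventually_nhds_conv_at)
        then have ev: "\<forall>\<^sub>F z in nhds (snd c p). in_chart c (\<lambda>p. L p $ i $ j) z =
            in_chart c (\<lambda>p. X p $ i $ j) z + (if i = j then a else 0) * in_chart c (A m) z"
          by eventually_elim (simp add: in_chart_def L mat_def)
        have "in_chart c (\<lambda>p. X p $ i $ j) analytic_on snd c ` (fst c - S)"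
          using Xij c by (simp add: meromorphic_fun_def)
        then have "in_chart c (\<lambda>p. X p $ i $ j) analytic_on {snd c p}"
          by (rule analytic_on_subset) (use p in auto)
        moreover have "in_chart c (A m) analytic_on {snd c p}"
          using kn_analytic[OF c] by (rule analytic_on_subset) (use p in \<open>auto simp: singular_points_def\<close>)
        ultimately have "(\<lambda>z. in_chart c (\<lambda>p. X p $ i $ j) z + (if i = j then a else 0) * in_chart c (A m) z) analytic_on {snd c p}"
          by (intro analytic_intros)
        then show "in_chart c (\<lambda>p. L p $ i $ j) analytic_on {snd c p}"
          using analytic_at_cong[OF ev refl] by blast
      qed
    next
      fix p assume "p \<in> S"
      then show "L p $ i $ j = 0" using Xij by (simp add: L meromorphic_fun_def)
    qed
  next
    fix s c assume s: "s \<in> I" and cs: "c \<in> charts_at \<Phi> (\<gamma> s)"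
    then have c: "c \<in> \<Phi>" "\<gamma> s \<in> fst c" by (auto simp: charts_at_def)
    define x where "x = laurent_at c (\<gamma> s) (A m)"
    have "\<gamma> s \<notin> {Pp, Pm}" using \<gamma> s by auto
    then have "in_chart c (A m) analytic_on {snd c (\<gamma> s)}"
      using c by (intro analytic_on_subset[OF kn_analytic[OF c(1)]]) auto
    then obtain G where "(\<lambda>z. in_chart c (A m) (snd c (\<gamma> s) + z)) has_fps_expansion G"
      using analytic_at_imp_has_fps_expansion by blast
    then have "x = fps_to_fls G"
      unfolding x_def laurent_at_def by (intro laurent_expansion_eqI has_laurent_expansion_fps)
    then have x: "fls_nth x k = 0" if "k < 0" for k using that by simp
    have coeff: "mat_laurent_coeff c (\<gamma> s) L k = mat_laurent_coeff c (\<gamma> s) X k + mat (a * fls_nth x k)" for k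
      unfolding mat_expansion_coeff[OF exp[OF c]] mat_expansion_coeff[OF lax_expansion[OF X c]] fls_mat_nth_add
      by (simp add: x_def fls_mat_nth_def mat_def vec_eq_iff)
    have Xs: "(\<forall>k < -1. mat_laurent_coeff c (\<gamma> s) X k = 0) \<and>
            (\<exists>\<beta>. mat_laurent_coeff c (\<gamma> s) X (-1) = outer_product (\<alpha> s) \<beta> \<and>
                 scalar_product \<beta> (\<alpha> s) = 0) \<and>
            (\<exists>\<kappa>. mat_laurent_coeff c (\<gamma> s) X 0 *v \<alpha> s = \<kappa> *s \<alpha> s)"
      using X s cs by (simp add: lax_gl_def)
    show "mat_laurent_coeff c (\<gamma> s) L k = 0" if "k < -1" for k
      using Xs x[of k] that by (simp add: coeff)
    show "\<exists>\<beta>. mat_laurent_coeff c (\<gamma> s) L (-1) = outer_product (\<alpha> s) \<beta> \<and> scalar_product \<beta> (\<alpha> s) = 0"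
      using Xs x[of "-1"] by (simp add: coeff)
    obtain \<kappa> where "mat_laurent_coeff c (\<gamma> s) X 0 *v \<alpha> s = \<kappa> *s \<alpha> s" using Xs by blast
    then have "mat_laurent_coeff c (\<gamma> s) L 0 *v \<alpha> s = (\<kappa> + a * fls_nth x 0) *s \<alpha> s"
      by (simp add: coeff matrix_vector_mult_add_rdistrib mat_vector_mult vec.scale_left_distrib)
    then show "\<exists>\<kappa>. mat_laurent_coeff c (\<gamma> s) L 0 *v \<alpha> s = \<kappa> *s \<alpha> s" by blast
  qed
qed

section \<open>Vanishing of the residue outside a finite range of degrees\<close>

lemma residue_eq_0_if_regular_at_Pm:
  assumes L: "L \<in> V" and L': "L' \<in> V" and cp: "cp \<in> charts_at \<Phi> Pp" and cm: "cm \<in> charts_at \<Phi> Pm"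
    and reg: "0 \<le> fls_subdegree (laurent_at cm Pm (cocycle_form \<Omega> L L' cm))"
  shows "residue (in_chart cp (cocycle_form \<Omega> L L' cp)) (snd cp Pp) = 0"
proof -
  define \<omega> where "\<omega> = cocycle_form \<Omega> L L'"
  \<comment> \<open>The given charts are used at the marked points, since the hypothesis and the
    claim refer to them.\<close>
  define ch where "ch p = (if p = Pp then cp else if p = Pm then cm else SOME c. c \<in> charts_at \<Phi> p)" for p
  \<comment> \<open>An index below \<open>- int g\<close> makes \<open>A N\<close> vanish at
    \<open>Pm\<close>, so that \<open>Pp\<close> is its only pole; an index not above the order of
    the form makes this pole deep enough.\<close>
  define N where "N = min (- int g - 1) (fls_subdegree (laurent_at cp Pp (\<omega> cp)))"
  have N: "N < - int g" by (simp add: N_def)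
  then have ordP: "has_order \<Phi> Pp N (A N)" and ordM: "has_order \<Phi> Pm (- N - int g) (A N)"
    using kn by (auto simp: kn_basis_def)
  have "single_pole_form \<Phi> S \<omega> (A N) Pp ch"
  proof unfold_locales
    show "meromorphic_form \<Phi> S \<omega>"
      unfolding \<omega>_def using L L' by (rule meromorphic_cocycle_form)
    show "ch p \<in> charts_at \<Phi> p" for p
      using cp cm charts_at_nonempty[of p] by (simp add: ch_def some_in_eq)
    then show "0 \<le> fls_subdegree (laurent_at (ch p) p (\<omega> (ch p)))" if "p \<noteq> Pp" for p
    proof (cases "p = Pm")
      case True
      then show ?thesis using reg P_neq by (simp add: ch_def \<omega>_def)
    next
      case False
      then have "form_regular_at \<Phi> \<omega> p"
        unfolding \<omega>_def using L L' that by (intro cocycle_form_regular) auto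
      then show ?thesis using \<open>ch p \<in> charts_at \<Phi> p\<close> by (force simp: form_regular_at_def)
    qed
    fix c assume c: "c \<in> \<Phi>"
    show "in_chart c (A N) meromorphic_on snd c ` fst c" using c by (rule kn_meromorphic)
    show "in_chart c (A N) analytic_on snd c ` (fst c - {Pp})"
    proof -
      have "in_chart c (A N) analytic_on {snd c p}" if p: "p \<in> fst c" "p \<noteq> Pp" for p
      proof (cases "p = Pm")
        case False
        with p show ?thesis by (intro analytic_on_subset[OF kn_analytic[OF c]]) auto
      next
        case True
        have cP: "c \<in> charts_at \<Phi> p" using c p by (simp add: charts_at_def)
        \<comment> \<open>\<open>A N\<close> has a zero at \<open>Pm\<close>, so the normalised
          value 0 is the correct one there. Hence \<open>A N\<close> is continuous at
          \<open>Pm\<close>, and a continuous meromorphic function is analytic.\<close>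
        then have sub: "fls_subdegree (laurent_at c p (A N)) > 0"
          using ordM N True by (simp add: has_order_def)
        then have "in_chart c (A N) \<midarrow>snd c p\<rightarrow> fls_nth (laurent_at c p (A N)) 0"
          by (intro has_laurent_expansion_imp_tendsto[OF kn_expansion[OF c p(1)]]) simp
        then have "isCont (in_chart c (A N)) (snd c p)"
          using sub c p True kn_marked(2)[of N] by (simp add: isCont_def in_chart_def)
        moreover have "in_chart c (A N) meromorphic_on {snd c p}"
          using p by (intro meromorphic_on_subset[OF kn_meromorphic[OF c]]) auto
        ultimately show ?thesis by (intro meromorphic_at_isCont_imp_analytic)
      qed
      then show ?thesis by (subst analytic_on_analytic_at) blast
    qed
  next
    show "fls_subdegree (laurent_at (ch Pp) Pp (A N)) < 0"
      "fls_subdegree (laurent_at (ch Pp) Pp (A N)) \<le> fls_subdegree (laurent_at (ch Pp) Pp (\<omega> (ch Pp)))"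
      using ordP cp N by (simp_all add: has_order_def ch_def) (simp add: N_def)
  qed (use compact connected finite_S in auto)
  then have "residue (in_chart (ch Pp) (\<omega> (ch Pp))) (snd (ch Pp) Pp) = 0"
    by (rule single_pole_form.residue_single_pole)
  then show ?thesis by (simp add: ch_def \<omega>_def)
qed

lemma local_residue:
  "local_wrt \<G> (\<lambda>L L'. form_residue \<Phi> Pp (cocycle_form \<Omega> L L'))"
proof -
  define cp where "cp = (SOME c. c \<in> charts_at \<Phi> Pp)"
  have cp: "cp \<in> charts_at \<Phi> Pp"
    using some_in_eq[of "charts_at \<Phi> Pp"] charts_at_nonempty[of Pp] by (simp add: cp_def)
  then have cp': "cp \<in> \<Phi>" "Pp \<in> fst cp" by (auto simp: charts_at_def)
  obtain cm where cm: "cm \<in> charts_at \<Phi> Pm" using charts_at_nonempty by blast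
  then have cm': "cm \<in> \<Phi>" "Pm \<in> fst cm" by (auto simp: charts_at_def)
  define Wp where "Wp = (\<chi> i j. laurent_at cp Pp (\<lambda>q. \<Omega> cp q $ i $ j))"
  define Wm where "Wm = (\<chi> i j. laurent_at cm Pm (\<lambda>q. \<Omega> cm q $ i $ j))"
  have Wp: "mat_expansion cp Pp (\<Omega> cp) Wp" unfolding Wp_def using cp' by (rule form_expansion)
  have Wm: "mat_expansion cm Pm (\<Omega> cm) Wm" unfolding Wm_def using cm' by (rule form_expansion)
  obtain bp where bp: "\<And>k. k < bp \<Longrightarrow> fls_mat_nth Wp k = 0" using fls_mat_nth_lower_bound by blast
  obtain bm where bm: "\<And>k. k < bm \<Longrightarrow> fls_mat_nth Wm k = 0" using fls_mat_nth_lower_bound by blast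
  \<comment> \<open>At \<open>Pm\<close> the two elements have orders at least
    \<open>a = - m - g - 1\<close> and \<open>b = - m' - g - 1\<close>, and \<Omega> has order at
    least \<open>bm\<close>. Below this threshold \<open>a + b - 1\<close> and
    \<open>a + b + bm\<close> are both nonnegative, so the form is regular at
    \<open>Pm\<close>.\<close>
  define \<mu>1 where "\<mu>1 = min (- 2 * int g - 3) (bm - 2 * int g - 2)"
  \<comment> \<open>At \<open>Pp\<close> the coefficient of exponent -1 vanishes as soon as
    \<open>-1 < m + m' - 1\<close> and \<open>-1 < m + m' + bp\<close>.\<close>
  define \<mu>2 where "\<mu>2 = max 0 (- 1 - bp)"
  have "form_residue \<Phi> Pp (cocycle_form \<Omega> L L') = 0"
    if mm: "\<not> (\<mu>1 \<le> m + m' \<and> m + m' \<le> \<mu>2)" and L: "L \<in> \<G> m" and L': "L' \<in> \<G> m'" for m m' L L'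
  proof -
    have res: "form_residue \<Phi> Pp (cocycle_form \<Omega> L L') = residue (in_chart cp (cocycle_form \<Omega> L L' cp)) (snd cp Pp)"
      by (simp add: form_residue_def Let_def cp_def)
    consider "m + m' > \<mu>2" | "m + m' < \<mu>1" using mm by linarith
    then show ?thesis
    proof cases
      case 1
      obtain X where X: "mat_expansion cp Pp L X" "\<And>k. k < m \<Longrightarrow> fls_mat_nth X k = 0"
        using homogeneous_order[OF L cp, of m] by auto
      obtain Y where Y: "mat_expansion cp Pp L' Y" "\<And>k. k < m' \<Longrightarrow> fls_mat_nth Y k = 0"
        using homogeneous_order[OF L' cp, of m'] by auto
      have "residue (in_chart cp (cocycle_form \<Omega> L L' cp)) (snd cp Pp) = fls_residue (cocycle_fls Wp X Y)"
        by (intro has_laurent_expansion_residue cocycle_form_expansion cp' X Y Wp)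
      also have "\<dots> = 0"
        using 1 cocycle_fls_nth_eq_0[of m X m' Y bp Wp "-1"] X(2) Y(2) bp by (simp add: \<mu>2_def)
      finally show ?thesis by (simp add: res)
    next
      case 2
      obtain X where X: "mat_expansion cm Pm L X" "\<And>k. k < - m - int g - 1 \<Longrightarrow> fls_mat_nth X k = 0"
        using homogeneous_order[OF L cm, of "- m - int g - 1"] by auto
      obtain Y where Y: "mat_expansion cm Pm L' Y" "\<And>k. k < - m' - int g - 1 \<Longrightarrow> fls_mat_nth Y k = 0"
        using homogeneous_order[OF L' cm, of "- m' - int g - 1"] by auto
      have "laurent_at cm Pm (cocycle_form \<Omega> L L' cm) = cocycle_fls Wm X Y"
        unfolding laurent_at_def by (intro laurent_expansion_eqI cocycle_form_expansion cm' X Y Wm)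
      moreover have "fls_nth (cocycle_fls Wm X Y) k = 0" if "k < 0" for k
        using 2 that by (intro cocycle_fls_nth_eq_0[OF X(2) Y(2) bm]) (auto simp: \<mu>1_def)
      then have "0 \<le> fls_subdegree (cocycle_fls Wm X Y)"
        using fls_nonneg_iff[of "cocycle_fls Wm X Y"] by auto
      ultimately show ?thesis
        unfolding res using L L' homogeneous_subset
        by (intro residue_eq_0_if_regular_at_Pm[OF _ _ cp cm]) auto
    qed
  qed
  then show ?thesis unfolding local_wrt_def by blast
qed

end

theorem theorem4p3:
  fixes \<Phi> :: "('a::t2_space) chart set"
    and g :: nat
    and Pp Pm :: 'a
    and \<gamma> :: "nat \<Rightarrow> 'a"
    and \<alpha> :: "nat \<Rightarrow> complex^'n"
    and A :: "int \<Rightarrow> 'a \<Rightarrow> complex"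
    and \<Omega> :: "('a, complex^'n^'n) form"
    and I :: "nat set"
  assumes "compact_riemann_surface \<Phi>"
    and "has_genus (euclidean :: 'a topology) g"
    and "Pp \<noteq> Pm"
    and "kn_basis \<Phi> g Pp Pm A"
    and "I = {1..CARD('n) * g}"
    and "inj_on \<gamma> I"
    and "Pp \<notin> \<gamma> ` I" and "Pm \<notin> \<gamma> ` I"
    and "\<And>s. s \<in> I \<Longrightarrow> \<alpha> s \<noteq> 0"
    and "lax_form \<Phi> Pp Pm I \<gamma> \<alpha> \<Omega>"
  shows "(\<forall>L \<in> lax_gl \<Phi> Pp Pm I \<gamma> \<alpha>. \<forall>L' \<in> lax_gl \<Phi> Pp Pm I \<gamma> \<alpha>.
            meromorphic_form \<Phi> (singular_points Pp Pm I \<gamma>) (cocycle_form \<Omega> L L') \<and>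
            (\<forall>p. p \<notin> {Pp, Pm} \<longrightarrow> form_regular_at \<Phi> (cocycle_form \<Omega> L L') p)) \<and>
         two_cocycle (lax_gl \<Phi> Pp Pm I \<gamma> \<alpha>)
            (\<lambda>L L'. form_residue \<Phi> Pp (cocycle_form \<Omega> L L')) \<and>
         local_wrt (lax_gl_homogeneous \<Phi> g Pp Pm I \<gamma> \<alpha> A)
            (\<lambda>L L'. form_residue \<Phi> Pp (cocycle_form \<Omega> L L'))"
proof -
  interpret lax_data_kn \<Phi> Pp Pm I \<gamma> \<alpha> \<Omega> g A
    using assms by unfold_locales (simp_all add: compact_riemann_surface_def)
  show ?thesis
    using meromorphic_cocycle_form cocycle_form_regular two_cocycle_residue local_residue by blast
qed

end
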